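(* Let $(M,E)$ be a Finsler manifold. The Hashiguchi connection $D^{\star}$ is uniquely determined by the following relations, for all $\zeta,\eta\in\mathfrak{X}(TM)$: (a) $D^{\star}_{J\zeta}J\eta=D^{\circ}_{J\zeta}J\eta+\mathcal{C}(\zeta,\eta)$; (b) $D^{\star}_{h\zeta}J\eta=D^{\circ}_{h\zeta}J\eta$; (c) $D^{\star}F=0$. That is, $D^{\star}$ satisfies (a)–(c) and is the only linear connection on $TM$ that does. Here $D^{\circ}$ is the Berwald connection.
   Context: Setting. $M$ is an $n$-dimensional smooth manifold, $\mathcal{T}M=TM\setminus\{0\}$, and all objects "on $TM$" below (vector fields $\mathfrak{X}(TM)$, linear connections on $TM$, i.e. covariant derivatives of vector fields on $TM$) are considered over $\mathcal{T}M$, where they are smooth. In induced coordinates $(x^i,y^i)$, $J=\frac{\partial}{\partial y^i}\otimes dx^i$ is the almost tangent structure (so $\mathrm{Im}\,J=\ker J=V(TM)$, the vertical bundle) and $C=y^i\frac{\partial}{\partial y^i}$ is the Liouville vector field. A Finsler manifold $(M,E)$ is $M$ with $E:TM\to\mathbb{R}$ such that $E>0$ on $\mathcal{T}M$, $E(0)=0$, $E$ is smooth on $\mathcal{T}M$ and $C^1$ on $TM$, $\mathcal{L}_CE=2E$ (positively homogeneous of degree 2), and $\Omega:=dd_JE$ has maximal rank, where $d_JE(\zeta)=dE(J\zeta)$. The canonical spray $S$ is the unique vector field with $i_S\Omega=-dE$ ($JS=C$, $[C,S]=S$). The Barthel connection is $\Gamma=[J,S]$, i.e. $\Gamma\zeta=[J\zeta,S]-J[\zeta,S]$,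 with projectors $h=\frac12(I+\Gamma)$, $v=\frac12(I-\Gamma)$; the associated almost complex structure $F$ is defined by $FJ=h$, $Fh=-J$. The metric $g$ on $T(TM)$ is $g(\zeta,\xi)=\overline g(J\zeta,J\xi)+\overline g(v\zeta,v\xi)$ with $\overline g(J\zeta,J\xi)=\Omega(J\zeta,\xi)$. The first Cartan tensor $\mathcal{C}$ is the vertical-vector-valued tensor ($J\mathcal{C}=0$) defined by $\Omega(\mathcal{C}(\zeta,\eta),\xi)=\frac12(\mathcal{L}_{J\zeta}(J^{*}g))(\eta,\xi)$, with $(J^{*}g)(\eta,\xi)=g(J\eta,J\xi)$; it is symmetric and semi-basic (vanishes if an argument is vertical), and $\mathcal{C}(\eta,S)=0$. Berwald connection $D^{\circ}$: the linear connection on $TM$ given by $D^{\circ}_{J\zeta}J\xi=J[J\zeta,\xi]$, $D^{\circ}_{h\zeta}J\xi=v[h\zeta,J\xi]$, $D^{\circ}F=0$. Hashiguchi connection $D^{\star}$: the unique linear connection on $TM$ that is a lift of $\Gamma$ (that is, $D^{\star}J=0$, $D^{\star}_\zeta C=v\zeta$, $D^{\star}\Gamma=0$) and satisfies, for all $\zeta,\eta$: $D^{\star}_{J\eta}g=0$, $T^{\star}(J\zeta,J\eta)=0$, $v\,T^{\star}(h\zeta,J\eta)=0$, where $T^{\star}(\zeta,\eta)=D^{\star}_\zeta\eta-D^{\star}_\eta\zeta-[\zeta,\eta]$. *)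

theory Defs
  imports "HOL-Analysis.Analysis"
begin

section \<open>Smooth maps between open subsets of Euclidean spaces\<close>

text \<open>Only used for open \<open>S\<close>. In finite dimension \<open>Ck_on k S f\<close> is the usual \<open>C\<^sup>k\<close>: all iterated
  directional derivatives up to order \<open>k\<close> exist and are continuous.\<close>

primrec Ck_on :: "nat \<Rightarrow> 'v::real_normed_vector set \<Rightarrow> ('v \<Rightarrow> 'w::real_normed_vector) \<Rightarrow> bool" where
  "Ck_on 0 S f \<longleftrightarrow> continuous_on S f"
| "Ck_on (Suc k) S f \<longleftrightarrow>
     (\<forall>x\<in>S. f differentiable (at x)) \<and>
     (\<forall>v. Ck_on k S (\<lambda>x. frechet_derivative f (at x) v))"

definition smooth_on :: "'v::real_normed_vector set \<Rightarrow> ('v \<Rightarrow> 'w::real_normed_vector) \<Rightarrow> bool" where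
  "smooth_on S f \<longleftrightarrow> (\<forall>k. Ck_on k S f)"

section \<open>Charts, tangent vectors and vector fields\<close>

text \<open>A chart is a pair of its domain and a total function, of which only the values on the domain
  matter.\<close>

type_synonym ('a, 'v) chart = "'a set \<times> ('a \<Rightarrow> 'v)"

abbreviation dom_of :: "('a, 'v) chart \<Rightarrow> 'a set" where
  "dom_of c \<equiv> fst c"

definition range_of :: "('a, 'v) chart \<Rightarrow> 'v set" where
  "range_of c = snd c ` fst c"

definition chart_inv :: "('a, 'v) chart \<Rightarrow> 'v \<Rightarrow> 'a" where
  "chart_inv c = inv_into (fst c) (snd c)"

definition transition :: "('a, 'v) chart \<Rightarrow> ('a, 'v) chart \<Rightarrow> 'v \<Rightarrow> 'v" where
  "transition c d = snd d \<circ> chart_inv c"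

definition carrier_of :: "('a, 'v) chart set \<Rightarrow> 'a set" where
  "carrier_of A = (\<Union>c\<in>A. dom_of c)"

definition charts_at :: "('a, 'v) chart set \<Rightarrow> 'a \<Rightarrow> ('a, 'v) chart set" where
  "charts_at A p = {c\<in>A. p \<in> dom_of c}"

text \<open>The dimension of the manifold is \<open>DIM('v)\<close>. The atlas need not be maximal.\<close>

definition smooth_manifold :: "'a topology \<Rightarrow> ('a, 'v::euclidean_space) chart set \<Rightarrow> bool" where
  "smooth_manifold M A \<longleftrightarrow>
     Hausdorff_space M \<and> second_countable M \<and> carrier_of A = topspace M \<and>
     (\<forall>c\<in>A. openin M (dom_of c) \<and> open (range_of c) \<and>
        homeomorphic_map (subtopology M (dom_of c)) (top_of_set (range_of c)) (snd c)) \<and>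
     (\<forall>c\<in>A. \<forall>d\<in>A. smooth_on (snd c ` (dom_of c \<inter> dom_of d)) (transition c d))"

text \<open>A tangent vector at \<open>p\<close> is the family of its components with respect to all charts around \<open>p\<close>,
  subject to the transformation law. It is \<open>undefined\<close> on all other charts, so that HOL equality of
  families is equality of tangent vectors.\<close>

type_synonym ('a, 'v) tvec = "('a, 'v) chart \<Rightarrow> 'v"

definition tangent_space ::
    "('a, 'v::real_normed_vector) chart set \<Rightarrow> 'a \<Rightarrow> ('a, 'v) tvec set" where
  "tangent_space A p = {w \<in> extensional (charts_at A p).
     \<forall>c\<in>charts_at A p. \<forall>d\<in>charts_at A p.
       w d = frechet_derivative (transition c d) (at (snd c p)) (w c)}"

definition zero_tvec :: "('a, 'v::real_normed_vector) chart set \<Rightarrow> 'a \<Rightarrow> ('a, 'v) tvec" where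
  "zero_tvec A p = (\<lambda>c\<in>charts_at A p. 0)"

definition smooth_functions :: "('a, 'v::real_normed_vector) chart set \<Rightarrow> ('a \<Rightarrow> real) set" where
  "smooth_functions A = {f. \<forall>c\<in>A. smooth_on (range_of c) (f \<circ> chart_inv c)}"

text \<open>Vector fields are likewise \<open>undefined\<close> outside the manifold.\<close>

type_synonym ('a, 'v) vfield = "'a \<Rightarrow> ('a, 'v) tvec"

definition vector_fields ::
    "('a, 'v::real_normed_vector) chart set \<Rightarrow> ('a, 'v) vfield set" where
  "vector_fields A = {X \<in> extensional (carrier_of A).
     (\<forall>p\<in>carrier_of A. X p \<in> tangent_space A p) \<and>
     (\<forall>c\<in>A. smooth_on (range_of c) (\<lambda>x. X (chart_inv c x) c))}"

definition mk_field :: "('a, 'v) chart set \<Rightarrow> ('a \<Rightarrow> ('a, 'v) chart \<Rightarrow> 'v) \<Rightarrow> ('a, 'v) vfield" where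
  "mk_field A \<Phi> = (\<lambda>p\<in>carrier_of A. \<lambda>c\<in>charts_at A p. \<Phi> p c)"

definition vf_zero :: "('a, 'v::real_normed_vector) chart set \<Rightarrow> ('a, 'v) vfield" where
  "vf_zero A = mk_field A (\<lambda>p c. 0)"

definition vf_add :: "('a, 'v::real_normed_vector) chart set \<Rightarrow>
    ('a, 'v) vfield \<Rightarrow> ('a, 'v) vfield \<Rightarrow> ('a, 'v) vfield" where
  "vf_add A X Y = mk_field A (\<lambda>p c. X p c + Y p c)"

definition vf_diff :: "('a, 'v::real_normed_vector) chart set \<Rightarrow>
    ('a, 'v) vfield \<Rightarrow> ('a, 'v) vfield \<Rightarrow> ('a, 'v) vfield" where
  "vf_diff A X Y = mk_field A (\<lambda>p c. X p c - Y p c)"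

definition vf_scale :: "('a, 'v::real_normed_vector) chart set \<Rightarrow>
    ('a \<Rightarrow> real) \<Rightarrow> ('a, 'v) vfield \<Rightarrow> ('a, 'v) vfield" where
  "vf_scale A f X = mk_field A (\<lambda>p c. f p *\<^sub>R X p c)"

text \<open>The derivative \<open>X f = df(X)\<close>, computed in any chart around the point.\<close>

definition vf_apply :: "('a, 'v::real_normed_vector) chart set \<Rightarrow>
    ('a, 'v) vfield \<Rightarrow> ('a \<Rightarrow> real) \<Rightarrow> 'a \<Rightarrow> real" where
  "vf_apply A X f p = (let c = (SOME c. c \<in> charts_at A p) in
     frechet_derivative (f \<circ> chart_inv c) (at (snd c p)) (X p c))"

definition bracket :: "('a, 'v::real_normed_vector) chart set \<Rightarrow>
    ('a, 'v) vfield \<Rightarrow> ('a, 'v) vfield \<Rightarrow> ('a, 'v) vfield" where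
  "bracket A X Y = mk_field A (\<lambda>p c.
     frechet_derivative (\<lambda>x. Y (chart_inv c x) c) (at (snd c p)) (X p c) -
     frechet_derivative (\<lambda>x. X (chart_inv c x) c) (at (snd c p)) (Y p c))"

text \<open>Lie derivative of a covariant 2-tensor, the latter acting on vector fields.\<close>

definition lie_derivative2 :: "('a, 'v::real_normed_vector) chart set \<Rightarrow> ('a, 'v) vfield \<Rightarrow>
    (('a, 'v) vfield \<Rightarrow> ('a, 'v) vfield \<Rightarrow> 'a \<Rightarrow> real) \<Rightarrow>
    ('a, 'v) vfield \<Rightarrow> ('a, 'v) vfield \<Rightarrow> 'a \<Rightarrow> real" where
  "lie_derivative2 A X b Y Z p =
     vf_apply A X (b Y Z) p - b (bracket A X Y) Z p - b Y (bracket A X Z) p"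

section \<open>Linear connections\<close>

type_synonym ('a, 'v) connection = "('a, 'v) vfield \<Rightarrow> ('a, 'v) vfield \<Rightarrow> ('a, 'v) vfield"

definition linear_connection ::
    "('a, 'v::real_normed_vector) chart set \<Rightarrow> ('a, 'v) connection \<Rightarrow> bool" where
  "linear_connection A D \<longleftrightarrow>
     (\<forall>X\<in>vector_fields A. \<forall>Y\<in>vector_fields A. D X Y \<in> vector_fields A) \<and>
     (\<forall>X\<in>vector_fields A. \<forall>X'\<in>vector_fields A. \<forall>Y\<in>vector_fields A.
        D (vf_add A X X') Y = vf_add A (D X Y) (D X' Y)) \<and>
     (\<forall>f\<in>smooth_functions A. \<forall>X\<in>vector_fields A. \<forall>Y\<in>vector_fields A.
        D (vf_scale A f X) Y = vf_scale A f (D X Y)) \<and>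
     (\<forall>X\<in>vector_fields A. \<forall>Y\<in>vector_fields A. \<forall>Y'\<in>vector_fields A.
        D X (vf_add A Y Y') = vf_add A (D X Y) (D X Y')) \<and>
     (\<forall>f\<in>smooth_functions A. \<forall>X\<in>vector_fields A. \<forall>Y\<in>vector_fields A.
        D X (vf_scale A f Y) = vf_add A (vf_scale A (vf_apply A X f) Y) (vf_scale A f (D X Y)))"

text \<open>\<open>D K = 0\<close> for a (1,1)-tensor field \<open>K\<close>, that is \<open>D\<^sub>X (K Y) - K (D\<^sub>X Y) = 0\<close>.\<close>

definition parallel11 :: "('a, 'v::real_normed_vector) chart set \<Rightarrow> ('a, 'v) connection \<Rightarrow>
    (('a, 'v) vfield \<Rightarrow> ('a, 'v) vfield) \<Rightarrow> bool" where
  "parallel11 A D K \<longleftrightarrow>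
     (\<forall>X\<in>vector_fields A. \<forall>Y\<in>vector_fields A. D X (K Y) = K (D X Y))"

definition covariant_derivative2 :: "('a, 'v::real_normed_vector) chart set \<Rightarrow>
    ('a, 'v) connection \<Rightarrow> ('a, 'v) vfield \<Rightarrow>
    (('a, 'v) vfield \<Rightarrow> ('a, 'v) vfield \<Rightarrow> 'a \<Rightarrow> real) \<Rightarrow>
    ('a, 'v) vfield \<Rightarrow> ('a, 'v) vfield \<Rightarrow> 'a \<Rightarrow> real" where
  "covariant_derivative2 A D X b Y Z p =
     vf_apply A X (b Y Z) p - b (D X Y) Z p - b Y (D X Z) p"

definition torsion :: "('a, 'v::real_normed_vector) chart set \<Rightarrow> ('a, 'v) connection \<Rightarrow>
    ('a, 'v) vfield \<Rightarrow> ('a, 'v) vfield \<Rightarrow> ('a, 'v) vfield" where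
  "torsion A D X Y = vf_diff A (vf_diff A (D X Y) (D Y X)) (bracket A X Y)"

section \<open>The tangent bundle and the slit tangent bundle\<close>

type_synonym ('a, 'v) tm = "'a \<times> ('a, 'v) tvec"

definition tangent_bundle :: "('a, 'v::real_normed_vector) chart set \<Rightarrow> ('a, 'v) tm set" where
  "tangent_bundle A = (SIGMA p:carrier_of A. tangent_space A p)"

text \<open>The induced charts have coordinates \<open>(x, y)\<close>.\<close>

definition tangent_atlas ::
    "('a, 'v::real_normed_vector) chart set \<Rightarrow> (('a, 'v) tm, 'v \<times> 'v) chart set" where
  "tangent_atlas A =
     (\<lambda>c. ({u \<in> tangent_bundle A. fst u \<in> dom_of c}, \<lambda>u. (snd c (fst u), snd u c))) ` A"

definition slit_bundle :: "('a, 'v::real_normed_vector) chart set \<Rightarrow> ('a, 'v) tm set" where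
  "slit_bundle A = {u \<in> tangent_bundle A. snd u \<noteq> zero_tvec A (fst u)}"

definition slit_atlas ::
    "('a, 'v::real_normed_vector) chart set \<Rightarrow> (('a, 'v) tm, 'v \<times> 'v) chart set" where
  "slit_atlas A = (\<lambda>k. (dom_of k \<inter> slit_bundle A, snd k)) ` tangent_atlas A"

type_synonym ('a, 'v) tm_field = "(('a, 'v) tm, 'v \<times> 'v) vfield"
type_synonym ('a, 'v) tm_connection = "(('a, 'v) tm, 'v \<times> 'v) connection"

text \<open>Vector fields "on \<open>TM\<close>" are only defined, and smooth, over the slit tangent bundle.\<close>

definition tm_fields :: "('a, 'v::real_normed_vector) chart set \<Rightarrow> ('a, 'v) tm_field set" where
  "tm_fields A = vector_fields (slit_atlas A)"

definition almost_tangent ::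
    "('a, 'v::real_normed_vector) chart set \<Rightarrow> ('a, 'v) tm_field \<Rightarrow> ('a, 'v) tm_field" where
  "almost_tangent A \<zeta> = mk_field (slit_atlas A) (\<lambda>u k. (0, fst (\<zeta> u k)))"

definition liouville :: "('a, 'v::real_normed_vector) chart set \<Rightarrow> ('a, 'v) tm_field" where
  "liouville A = mk_field (slit_atlas A) (\<lambda>u k. (0, snd (snd k u)))"

section \<open>Finsler manifolds\<close>

definition d_J :: "('a, 'v::real_normed_vector) chart set \<Rightarrow> (('a, 'v) tm \<Rightarrow> real) \<Rightarrow>
    ('a, 'v) tm_field \<Rightarrow> ('a, 'v) tm \<Rightarrow> real" where
  "d_J A E \<zeta> = vf_apply (slit_atlas A) (almost_tangent A \<zeta>) E"

text \<open>\<open>\<Omega> = d d\<^sub>J E\<close>, with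
  \<open>d\<theta>(\<zeta>, \<eta>) = \<zeta> (\<theta> \<eta>) - \<eta> (\<theta> \<zeta>) - \<theta> [\<zeta>, \<eta>]\<close>. There is no factor \<open>1/2\<close>; this is the normalization
  for which \<open>i\<^sub>S \<Omega> = - dE\<close> and \<open>J S = C\<close> are compatible.\<close>

definition Omega :: "('a, 'v::real_normed_vector) chart set \<Rightarrow> (('a, 'v) tm \<Rightarrow> real) \<Rightarrow>
    ('a, 'v) tm_field \<Rightarrow> ('a, 'v) tm_field \<Rightarrow> ('a, 'v) tm \<Rightarrow> real" where
  "Omega A E \<zeta> \<eta> u =
     vf_apply (slit_atlas A) \<zeta> (d_J A E \<eta>) u - vf_apply (slit_atlas A) \<eta> (d_J A E \<zeta>) u
     - d_J A E (bracket (slit_atlas A) \<zeta> \<eta>) u"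

text \<open>Maximal rank means that the radical of the bilinear form \<open>\<Omega>\<^sub>u\<close> on the tangent space at \<open>u\<close>
  vanishes for each \<open>u\<close>. Tangent vectors at \<open>u\<close> are represented as values at \<open>u\<close> of vector fields.\<close>

definition maximal_rank :: "('a, 'v::real_normed_vector) chart set \<Rightarrow>
    (('a, 'v) tm_field \<Rightarrow> ('a, 'v) tm_field \<Rightarrow> ('a, 'v) tm \<Rightarrow> real) \<Rightarrow> bool" where
  "maximal_rank A \<omega> \<longleftrightarrow> (\<forall>u\<in>slit_bundle A. \<forall>\<zeta>\<in>tm_fields A.
     (\<forall>\<eta>\<in>tm_fields A. \<omega> \<zeta> \<eta> u = 0) \<longrightarrow> \<zeta> u = zero_tvec (slit_atlas A) u)"

definition finsler_manifold :: "'a topology \<Rightarrow> ('a, 'v::euclidean_space) chart set \<Rightarrow>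
    (('a, 'v) tm \<Rightarrow> real) \<Rightarrow> bool" where
  "finsler_manifold M A E \<longleftrightarrow>
     smooth_manifold M A \<and>
     (\<forall>u\<in>slit_bundle A. E u > 0) \<and>
     (\<forall>p\<in>carrier_of A. E (p, zero_tvec A p) = 0) \<and>
     E \<in> smooth_functions (slit_atlas A) \<and>
     (\<forall>k\<in>tangent_atlas A. Ck_on 1 (range_of k) (E \<circ> chart_inv k)) \<and>
     (\<forall>u\<in>slit_bundle A. vf_apply (slit_atlas A) (liouville A) E u = 2 * E u) \<and>
     maximal_rank A (Omega A E)"

text \<open>The spray, and below the Berwald and Hashiguchi connections, are introduced by their
  characterizing properties. Connections are compared only on vector fields, since their values on
  other arguments are irrelevant.\<close>

definition canonical_spray :: "('a, 'v::real_normed_vector) chart set \<Rightarrow>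
    (('a, 'v) tm \<Rightarrow> real) \<Rightarrow> ('a, 'v) tm_field \<Rightarrow> bool" where
  "canonical_spray A E S \<longleftrightarrow> S \<in> tm_fields A \<and>
     (\<forall>\<zeta>\<in>tm_fields A. \<forall>u\<in>slit_bundle A. Omega A E S \<zeta> u = - vf_apply (slit_atlas A) \<zeta> E u)"

definition barthel :: "('a, 'v::real_normed_vector) chart set \<Rightarrow>
    ('a, 'v) tm_field \<Rightarrow> ('a, 'v) tm_field \<Rightarrow> ('a, 'v) tm_field" where
  "barthel A S \<zeta> = vf_diff (slit_atlas A) (bracket (slit_atlas A) (almost_tangent A \<zeta>) S)
     (almost_tangent A (bracket (slit_atlas A) \<zeta> S))"

definition h_proj :: "('a, 'v::real_normed_vector) chart set \<Rightarrow>
    ('a, 'v) tm_field \<Rightarrow> ('a, 'v) tm_field \<Rightarrow> ('a, 'v) tm_field" where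
  "h_proj A S \<zeta> = vf_scale (slit_atlas A) (\<lambda>u. 1/2) (vf_add (slit_atlas A) \<zeta> (barthel A S \<zeta>))"

definition v_proj :: "('a, 'v::real_normed_vector) chart set \<Rightarrow>
    ('a, 'v) tm_field \<Rightarrow> ('a, 'v) tm_field \<Rightarrow> ('a, 'v) tm_field" where
  "v_proj A S \<zeta> = vf_scale (slit_atlas A) (\<lambda>u. 1/2) (vf_diff (slit_atlas A) \<zeta> (barthel A S \<zeta>))"

definition almost_complex :: "('a, 'v::real_normed_vector) chart set \<Rightarrow>
    ('a, 'v) tm_field \<Rightarrow> ('a, 'v) tm_field \<Rightarrow> ('a, 'v) tm_field" where
  "almost_complex A S = (THE F. F \<in> tm_fields A \<rightarrow>\<^sub>E tm_fields A \<and>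
     (\<forall>\<zeta>\<in>tm_fields A. \<forall>\<eta>\<in>tm_fields A.
        F (vf_add (slit_atlas A) \<zeta> \<eta>) = vf_add (slit_atlas A) (F \<zeta>) (F \<eta>)) \<and>
     (\<forall>f\<in>smooth_functions (slit_atlas A). \<forall>\<zeta>\<in>tm_fields A.
        F (vf_scale (slit_atlas A) f \<zeta>) = vf_scale (slit_atlas A) f (F \<zeta>)) \<and>
     (\<forall>\<zeta>\<in>tm_fields A. F (almost_tangent A \<zeta>) = h_proj A S \<zeta>) \<and>
     (\<forall>\<zeta>\<in>tm_fields A.
        F (h_proj A S \<zeta>) = vf_scale (slit_atlas A) (\<lambda>u. - 1) (almost_tangent A \<zeta>)))"

text \<open>\<open>g\<^sub>V (J\<zeta>, J\<xi>) = \<Omega> (J\<zeta>, \<xi>)\<close> on vertical fields. The choice of \<open>\<xi>\<close> is immaterial since \<open>\<Omega>\<close> vanishes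
  on pairs of vertical fields.\<close>

definition vertical_metric :: "('a, 'v::real_normed_vector) chart set \<Rightarrow> (('a, 'v) tm \<Rightarrow> real) \<Rightarrow>
    ('a, 'v) tm_field \<Rightarrow> ('a, 'v) tm_field \<Rightarrow> ('a, 'v) tm \<Rightarrow> real" where
  "vertical_metric A E X Y = Omega A E X (SOME \<xi>. \<xi> \<in> tm_fields A \<and> almost_tangent A \<xi> = Y)"

definition metric :: "('a, 'v::real_normed_vector) chart set \<Rightarrow> (('a, 'v) tm \<Rightarrow> real) \<Rightarrow>
    ('a, 'v) tm_field \<Rightarrow> ('a, 'v) tm_field \<Rightarrow> ('a, 'v) tm_field \<Rightarrow> ('a, 'v) tm \<Rightarrow> real" where
  "metric A E S \<zeta> \<xi> u =
     vertical_metric A E (almost_tangent A \<zeta>) (almost_tangent A \<xi>) u +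
     vertical_metric A E (v_proj A S \<zeta>) (v_proj A S \<xi>) u"

definition J_pullback_metric :: "('a, 'v::real_normed_vector) chart set \<Rightarrow>
    (('a, 'v) tm \<Rightarrow> real) \<Rightarrow> ('a, 'v) tm_field \<Rightarrow>
    ('a, 'v) tm_field \<Rightarrow> ('a, 'v) tm_field \<Rightarrow> ('a, 'v) tm \<Rightarrow> real" where
  "J_pullback_metric A E S \<eta> \<xi> = metric A E S (almost_tangent A \<eta>) (almost_tangent A \<xi>)"

text \<open>Only the values of \<open>\<Omega> (X, \<xi>)\<close> on the slit bundle are constrained; non-degeneracy of \<open>\<Omega>\<close> makes
  \<open>X\<close> unique.\<close>

definition cartan :: "('a, 'v::real_normed_vector) chart set \<Rightarrow> (('a, 'v) tm \<Rightarrow> real) \<Rightarrow>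
    ('a, 'v) tm_field \<Rightarrow> ('a, 'v) tm_field \<Rightarrow> ('a, 'v) tm_field \<Rightarrow> ('a, 'v) tm_field" where
  "cartan A E S \<zeta> \<eta> = (THE X. X \<in> tm_fields A \<and>
     almost_tangent A X = vf_zero (slit_atlas A) \<and>
     (\<forall>\<xi>\<in>tm_fields A. \<forall>u\<in>slit_bundle A.
        Omega A E X \<xi> u =
          1/2 * lie_derivative2 (slit_atlas A) (almost_tangent A \<zeta>) (J_pullback_metric A E S) \<eta> \<xi> u))"

section \<open>The Berwald and Hashiguchi connections\<close>

definition berwald_connection :: "('a, 'v::real_normed_vector) chart set \<Rightarrow>
    ('a, 'v) tm_field \<Rightarrow> ('a, 'v) tm_connection \<Rightarrow> bool" where
  "berwald_connection A S D \<longleftrightarrow>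
     linear_connection (slit_atlas A) D \<and>
     (\<forall>\<zeta>\<in>tm_fields A. \<forall>\<xi>\<in>tm_fields A.
        D (almost_tangent A \<zeta>) (almost_tangent A \<xi>) =
          almost_tangent A (bracket (slit_atlas A) (almost_tangent A \<zeta>) \<xi>)) \<and>
     (\<forall>\<zeta>\<in>tm_fields A. \<forall>\<xi>\<in>tm_fields A.
        D (h_proj A S \<zeta>) (almost_tangent A \<xi>) =
          v_proj A S (bracket (slit_atlas A) (h_proj A S \<zeta>) (almost_tangent A \<xi>))) \<and>
     parallel11 (slit_atlas A) D (almost_complex A S)"

definition lift_of_barthel :: "('a, 'v::real_normed_vector) chart set \<Rightarrow>
    ('a, 'v) tm_field \<Rightarrow> ('a, 'v) tm_connection \<Rightarrow> bool" where
  "lift_of_barthel A S D \<longleftrightarrow>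
     parallel11 (slit_atlas A) D (almost_tangent A) \<and>
     (\<forall>\<zeta>\<in>tm_fields A. D \<zeta> (liouville A) = v_proj A S \<zeta>) \<and>
     parallel11 (slit_atlas A) D (barthel A S)"

definition hashiguchi_connection :: "('a, 'v::real_normed_vector) chart set \<Rightarrow>
    (('a, 'v) tm \<Rightarrow> real) \<Rightarrow> ('a, 'v) tm_field \<Rightarrow> ('a, 'v) tm_connection \<Rightarrow> bool" where
  "hashiguchi_connection A E S D \<longleftrightarrow>
     linear_connection (slit_atlas A) D \<and>
     lift_of_barthel A S D \<and>
     (\<forall>\<eta>\<in>tm_fields A. \<forall>\<zeta>\<in>tm_fields A. \<forall>\<xi>\<in>tm_fields A. \<forall>u\<in>slit_bundle A.
        covariant_derivative2 (slit_atlas A) D (almost_tangent A \<eta>) (metric A E S) \<zeta> \<xi> u = 0) \<and>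
     (\<forall>\<zeta>\<in>tm_fields A. \<forall>\<eta>\<in>tm_fields A.
        torsion (slit_atlas A) D (almost_tangent A \<zeta>) (almost_tangent A \<eta>) =
          vf_zero (slit_atlas A)) \<and>
     (\<forall>\<zeta>\<in>tm_fields A. \<forall>\<eta>\<in>tm_fields A.
        v_proj A S (torsion (slit_atlas A) D (h_proj A S \<zeta>) (almost_tangent A \<eta>)) =
          vf_zero (slit_atlas A))"

end

theory Submission
  imports Defs
begin

text \<open>Everything takes place on global vector fields over the slit tangent bundle. Non-degeneracy of
  \<open>\<Omega>\<close> gives \<open>JS = C\<close>, hence \<open>J [V, S] = V\<close> for every vertical \<open>V\<close>; so vertical fields are images under
  \<open>J\<close>, and \<open>F X = h [v X, S] - J X\<close>. A lift of \<open>\<Gamma>\<close> commutes with \<open>J\<close>, \<open>h\<close> and \<open>v\<close>, therefore with \<open>F\<close>, and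
  the mixed torsion condition forces \<open>D\<^bsub>hX\<^esub> JY = v [hX, JY]\<close>. For the vertical part put
  \<open>W X Y = D\<^bsub>JX\<^esub> JY - J [JX, Y]\<close>. Metricity turns \<open>\<L>\<^bsub>JX\<^esub> (J\<^sup>*g) (Y, Z)\<close> into
  \<open>\<Omega> (W X Y, Z) + \<Omega> (W X Z, Y)\<close>, vanishing vertical torsion makes \<open>W\<close> symmetric, and \<open>\<L>\<^bsub>JX\<^esub> (J\<^sup>*g)\<close> is totally
  symmetric in \<open>X, Y, Z\<close> by the Jacobi identity and the vanishing Nijenhuis tensor of \<open>J\<close>; so Christoffel's
  permutation argument identifies \<open>W\<close> with the first Cartan tensor. Conversely a connection with \<open>DF = 0\<close> is
  determined by its values on vertical fields, because \<open>h Y = F (J Y)\<close> and \<open>v Y\<close> is vertical.\<close>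

section \<open>Calculus of smooth maps\<close>

text \<open>Connections act on global fields, so a pointwise argument would need extensions of
  tangent vectors and local frames. The lift \<open>V \<mapsto> \<lbrakk>V, S\<rbrakk>\<close> takes
  their place: it is a canonical global right inverse of \<open>J\<close> on vertical fields, and it
  gives both \<open>F\<close> and the determination of a connection without bump functions. Likewise
  \<open>\<Omega>\<close> is only ever paired with fields: non-degeneracy serves to conclude that
  two fields with equal pairings against all fields coincide.

  The analytic burden is concentrated in one commutator rule for derivatives along vector fields in
  coordinates. It rests on the symmetry of mixed second derivatives and is proved once, for
  vector-valued maps, because it is applied to maps of three different kinds.

  The constant \<open>1/2\<close> in the first Cartan tensor is the one of Christoffel's argument:
  three permuted copies of the metricity equation add up to twice the unknown, and total symmetry
  makes these copies equal, so that their signed sum is a single copy.\<close>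

lemma has_derivative_cong_open:
  assumes "open S" "x \<in> S" "\<And>y. y \<in> S \<Longrightarrow> f y = g y"
  shows "(f has_derivative D) (at x) \<longleftrightarrow> (g has_derivative D) (at x)"
  using assms has_derivative_transform_within_open[of f D x UNIV S g]
    has_derivative_transform_within_open[of g D x UNIV S f] by auto

lemma frechet_derivative_cong_open:
  assumes "open S" "x \<in> S" "\<And>y. y \<in> S \<Longrightarrow> f y = g y"
  shows "frechet_derivative f (at x) = frechet_derivative g (at x)"
  unfolding frechet_derivative_def using has_derivative_cong_open[OF assms] by simp

lemma differentiable_cong_open:
  assumes "open S" "x \<in> S" "\<And>y. y \<in> S \<Longrightarrow> f y = g y"
  shows "f differentiable at x \<longleftrightarrow> g differentiable at x"
  unfolding differentiable_def using has_derivative_cong_open[OF assms] by simp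

lemma frechet_derivative_eqI:
  "(f has_derivative D) (at x) \<Longrightarrow> frechet_derivative f (at x) v = D v"
  using frechet_derivative_at by metis

lemma has_frechet_derivative:
  "f differentiable at x \<Longrightarrow> (f has_derivative (\<lambda>v. frechet_derivative f (at x) v)) (at x)"
  by (simp add: frechet_derivative_works)

section \<open>Closure properties of the classes \<open>Ck_on\<close> on open sets\<close>

lemma Ck_on_cong:
  assumes "open S" "\<And>x. x \<in> S \<Longrightarrow> f x = g x"
  shows "Ck_on k S f \<longleftrightarrow> Ck_on k S g"
  using assms(2)
proof (induction k arbitrary: f g)
  case 0
  then have "continuous_on S f \<longleftrightarrow> continuous_on S g" by (intro continuous_on_cong) auto
  then show ?case by simp
next
  case (Suc k)
  have "Ck_on k S (\<lambda>x. frechet_derivative f (at x) v) \<longleftrightarrow>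
      Ck_on k S (\<lambda>x. frechet_derivative g (at x) v)" for v
    by (rule Suc.IH) (simp add: frechet_derivative_cong_open[OF assms(1) _ Suc.prems])
  then show ?case
    using differentiable_cong_open[OF assms(1) _ Suc.prems] by auto
qed

lemma Ck_on_subset: "Ck_on k S f \<Longrightarrow> T \<subseteq> S \<Longrightarrow> Ck_on k T f"
proof (induction k arbitrary: f)
  case (Suc k)
  have "Ck_on k T (\<lambda>x. frechet_derivative f (at x) v)" for v
    using Suc by auto
  then show ?case using Suc.prems by auto
qed (auto intro: continuous_on_subset)

text \<open>The product rule leaves one factor undifferentiated, so its induction needs the factors
  at one order lower as well.\<close>

lemma Ck_on_SucD: "Ck_on (Suc k) S f \<Longrightarrow> Ck_on k S f"
proof (induction k arbitrary: f)
  case 0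
  then show ?case
    by (auto simp: differentiable_imp_continuous_within continuous_at_imp_continuous_on)
next
  case (Suc k)
  have "\<forall>v. Ck_on k S (\<lambda>x. frechet_derivative f (at x) v)"
    using Suc.IH Suc.prems unfolding Ck_on.simps(2)[of "Suc k"] by blast
  with Suc.prems show ?case by simp
qed

lemma Ck_on_const: "Ck_on k S (\<lambda>x. c)"
  by (induction k arbitrary: c) auto

lemma Ck_on_add:
  assumes "open S"
  shows "Ck_on k S f \<Longrightarrow> Ck_on k S g \<Longrightarrow> Ck_on k S (\<lambda>x. f x + g x)"
proof (induction k arbitrary: f g)
  case (Suc k)
  have "Ck_on k S (\<lambda>x. frechet_derivative (\<lambda>x. f x + g x) (at x) v)" for v
  proof (subst Ck_on_cong[OF assms])
    show "frechet_derivative (\<lambda>x. f x + g x) (at x) v =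
        frechet_derivative f (at x) v + frechet_derivative g (at x) v" if "x \<in> S" for x
      using Suc.prems that
      by (auto intro!: frechet_derivative_eqI has_derivative_add has_frechet_derivative)
    show "Ck_on k S (\<lambda>x. frechet_derivative f (at x) v + frechet_derivative g (at x) v)"
      using Suc by auto
  qed
  then show ?case using Suc.prems by auto
qed (auto intro: continuous_intros)

lemma Ck_on_bounded_bilinear:
  assumes "open S" "bounded_bilinear B"
  shows "Ck_on k S f \<Longrightarrow> Ck_on k S g \<Longrightarrow> Ck_on k S (\<lambda>x. B (f x) (g x))"
proof (induction k arbitrary: f g)
  case 0
  then show ?case using bounded_bilinear.continuous_on[OF assms(2)] by auto
next
  case (Suc k)
  have D: "((\<lambda>x. B (f x) (g x)) has_derivative (\<lambda>v. B (f x) (frechet_derivative g (at x) v) +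
        B (frechet_derivative f (at x) v) (g x))) (at x)" if "x \<in> S" for x
    using Suc.prems that
    by (intro bounded_bilinear.FDERIV[OF assms(2)] has_frechet_derivative) auto
  have "Ck_on k S (\<lambda>x. frechet_derivative (\<lambda>x. B (f x) (g x)) (at x) v)" for v
  proof (subst Ck_on_cong[OF assms(1)])
    show "frechet_derivative (\<lambda>x. B (f x) (g x)) (at x) v = B (f x) (frechet_derivative g (at x) v) +
        B (frechet_derivative f (at x) v) (g x)" if "x \<in> S" for x
      using frechet_derivative_eqI[OF D[OF that]] .
    show "Ck_on k S (\<lambda>x. B (f x) (frechet_derivative g (at x) v) +
        B (frechet_derivative f (at x) v) (g x))"
      using Suc.prems by (intro Ck_on_add[OF assms(1)] Suc.IH) (auto intro: Ck_on_SucD)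
  qed
  then show ?case using D by (auto simp: differentiable_def)
qed

lemma Ck_on_bounded_linear:
  assumes "open S" "bounded_linear L"
  shows "Ck_on k S f \<Longrightarrow> Ck_on k S (\<lambda>x. L (f x))"
proof (induction k arbitrary: f)
  case 0
  then show ?case using bounded_linear.continuous_on[OF assms(2)] by auto
next
  case (Suc k)
  have D: "((\<lambda>x. L (f x)) has_derivative (\<lambda>v. L (frechet_derivative f (at x) v))) (at x)"
    if "x \<in> S" for x
    using Suc.prems that by (intro bounded_linear.has_derivative[OF assms(2)] has_frechet_derivative) auto
  have "Ck_on k S (\<lambda>x. frechet_derivative (\<lambda>x. L (f x)) (at x) v)" for v
    using Suc by (subst Ck_on_cong[OF assms(1) frechet_derivative_eqI[OF D]]) auto
  then show ?case using D by (auto simp: differentiable_def)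
qed

text \<open>Meant for the projection from induced coordinates to base coordinates. For a linear
  inner map the derivative keeps its shape, with outer direction \<open>L v\<close>, so the
  induction closes.\<close>

lemma Ck_on_linear_comp:
  assumes "open S" "bounded_linear L" "open T" "L ` T \<subseteq> S"
  shows "Ck_on k S f \<Longrightarrow> Ck_on k T (\<lambda>x. f (L x))"
proof (induction k arbitrary: f)
  case 0
  have "continuous_on T L" using bounded_linear.continuous_on[OF assms(2) continuous_on_id] .
  then show ?case using continuous_on_compose2[of S f T L] assms(4) 0 by simp
next
  case (Suc k)
  have D: "((\<lambda>x. f (L x)) has_derivative (\<lambda>v. frechet_derivative f (at (L x)) (L v))) (at x)"
    if "x \<in> T" for x
    using has_derivative_compose[OF bounded_linear_imp_has_derivative[OF assms(2)]
        has_frechet_derivative[of f "L x"], of UNIV] Suc.prems that assms(4) by auto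
  have "Ck_on k T (\<lambda>x. frechet_derivative (\<lambda>x. f (L x)) (at x) v)" for v
    using Suc by (subst Ck_on_cong[OF assms(3) frechet_derivative_eqI[OF D]]) auto
  then show ?case using D by (auto simp: differentiable_def)
qed

lemma smooth_on_cong:
  "open S \<Longrightarrow> (\<And>x. x \<in> S \<Longrightarrow> f x = g x) \<Longrightarrow> smooth_on S f \<longleftrightarrow> smooth_on S g"
  unfolding smooth_on_def using Ck_on_cong by blast

lemma smooth_on_subset: "smooth_on S f \<Longrightarrow> T \<subseteq> S \<Longrightarrow> smooth_on T f"
  unfolding smooth_on_def using Ck_on_subset by blast

lemma smooth_on_const: "smooth_on S (\<lambda>x. c)"
  unfolding smooth_on_def using Ck_on_const by blast

lemma smooth_on_add:
  "open S \<Longrightarrow> smooth_on S f \<Longrightarrow> smooth_on S g \<Longrightarrow> smooth_on S (\<lambda>x. f x + g x)"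
  unfolding smooth_on_def using Ck_on_add by blast

lemma smooth_on_bounded_linear:
  "open S \<Longrightarrow> bounded_linear L \<Longrightarrow> smooth_on S f \<Longrightarrow> smooth_on S (\<lambda>x. L (f x))"
  unfolding smooth_on_def using Ck_on_bounded_linear by blast

lemma smooth_on_linear_comp:
  "open S \<Longrightarrow> bounded_linear L \<Longrightarrow> open T \<Longrightarrow> L ` T \<subseteq> S \<Longrightarrow> smooth_on S f \<Longrightarrow>
     smooth_on T (\<lambda>x. f (L x))"
  unfolding smooth_on_def using Ck_on_linear_comp by blast

lemma smooth_on_scaleR:
  "open S \<Longrightarrow> smooth_on S f \<Longrightarrow> smooth_on S g \<Longrightarrow> smooth_on S (\<lambda>x. f x *\<^sub>R g x)"
  unfolding smooth_on_def using Ck_on_bounded_bilinear[OF _ bounded_bilinear_scaleR] by blast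

lemma smooth_on_differentiable: "smooth_on S f \<Longrightarrow> x \<in> S \<Longrightarrow> f differentiable at x"
  unfolding smooth_on_def by (meson Ck_on.simps(2))

lemma smooth_on_deriv: "smooth_on S f \<Longrightarrow> smooth_on S (\<lambda>x. frechet_derivative f (at x) v)"
  unfolding smooth_on_def using Ck_on.simps(2) by blast

lemma smooth_on_has_derivative:
  "smooth_on S f \<Longrightarrow> x \<in> S \<Longrightarrow> (f has_derivative (\<lambda>v. frechet_derivative f (at x) v)) (at x)"
  using has_frechet_derivative smooth_on_differentiable by blast

lemma smooth_on_continuous: "smooth_on S f \<Longrightarrow> continuous_on S f"
  unfolding smooth_on_def by (metis Ck_on.simps(1))

lemma smooth_on_linear:
  assumes "open S" "bounded_linear L" shows "smooth_on S L"
proof -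
  have "Ck_on k S (\<lambda>x. x :: 'a)" for k
    using assms(1) by (cases k) (auto simp: Ck_on_const)
  then show ?thesis
    using smooth_on_bounded_linear[OF assms, of "\<lambda>x. x"] by (simp add: smooth_on_def)
qed

lemma smooth_on_minus: "open S \<Longrightarrow> smooth_on S f \<Longrightarrow> smooth_on S (\<lambda>x. - f x)"
  using smooth_on_bounded_linear[OF _ bounded_linear_minus[OF bounded_linear_ident]] .

lemma smooth_on_diff:
  "open S \<Longrightarrow> smooth_on S f \<Longrightarrow> smooth_on S g \<Longrightarrow> smooth_on S (\<lambda>x. f x - g x)"
  using smooth_on_add[OF _ _ smooth_on_minus] by fastforce

lemma smooth_on_sum:
  assumes "open S" shows "(\<And>i. i \<in> I \<Longrightarrow> smooth_on S (f i)) \<Longrightarrow> smooth_on S (\<lambda>x. \<Sum>i\<in>I. f i x)"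
  by (induction I rule: infinite_finite_induct) (auto intro: smooth_on_const smooth_on_add[OF assms])

lemma smooth_on_Pair:
  assumes "open S" "smooth_on S f" "smooth_on S g" shows "smooth_on S (\<lambda>x. (f x, g x))"
proof -
  have "smooth_on S (\<lambda>x. (f x, 0) + (0, g x))"
    by (rule smooth_on_add[OF assms(1)
        smooth_on_bounded_linear[OF assms(1) bounded_linear_Pair[OF bounded_linear_ident bounded_linear_zero] assms(2)]
        smooth_on_bounded_linear[OF assms(1) bounded_linear_Pair[OF bounded_linear_zero bounded_linear_ident] assms(3)]])
  then show ?thesis by simp
qed

lemma frechet_derivative_euclidean:
  fixes f :: "'v::euclidean_space \<Rightarrow> 'w::real_normed_vector"
  assumes "f differentiable at x"
  shows "frechet_derivative f (at x) v = (\<Sum>b\<in>Basis. (v \<bullet> b) *\<^sub>R frechet_derivative f (at x) b)"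
proof -
  have "linear (frechet_derivative f (at x))" using linear_frechet_derivative[OF assms] .
  then have "frechet_derivative f (at x) (\<Sum>b\<in>Basis. (v \<bullet> b) *\<^sub>R b) =
      (\<Sum>b\<in>Basis. (v \<bullet> b) *\<^sub>R frechet_derivative f (at x) b)"
    by (simp add: linear_sum linear_scale)
  then show ?thesis by (simp add: euclidean_representation)
qed

text \<open>Coordinate form of the derivative of \<open>f\<close> along \<open>X\<close>. Values may
  be vectors, so that components of fields and transition maps can be differentiated too.\<close>

definition dderiv :: "('v::real_normed_vector \<Rightarrow> 'v) \<Rightarrow> ('v \<Rightarrow> 'w::real_normed_vector) \<Rightarrow> 'v \<Rightarrow> 'w" where
  "dderiv X f x = frechet_derivative f (at x) (X x)"

text \<open>\<open>Ck_on\<close> controls derivatives in fixed directions only. Expanding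
  \<open>X x\<close> in the finite basis replaces the variable direction by fixed ones with smooth
  coefficients.\<close>

lemma smooth_on_dderiv:
  fixes f :: "'v::euclidean_space \<Rightarrow> 'w::real_normed_vector"
  assumes "open S" "smooth_on S f" "smooth_on S X"
  shows "smooth_on S (dderiv X f)"
proof -
  have "smooth_on S (\<lambda>x. \<Sum>b\<in>Basis. (X x \<bullet> b) *\<^sub>R frechet_derivative f (at x) b)"
    by (intro smooth_on_sum[OF assms(1)] smooth_on_scaleR[OF assms(1)] smooth_on_deriv[OF assms(2)]
        smooth_on_bounded_linear[OF assms(1) bounded_linear_inner_left assms(3)])
  then show ?thesis
    unfolding dderiv_def[abs_def]
    using smooth_on_cong[OF assms(1) frechet_derivative_euclidean[OF smooth_on_differentiable[OF assms(2)]]]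
    by fast
qed

section \<open>Symmetry of mixed second derivatives\<close>

lemma second_difference:
  fixes f :: "'v::real_normed_vector \<Rightarrow> real"
  assumes S: "ball x r \<subseteq> S" and f: "smooth_on S f" and h: "h > 0" "h * (norm v + norm w) < r"
  shows "\<exists>p\<in>ball x r. dist x p \<le> h * (norm v + norm w) \<and>
      f (x + h *\<^sub>R v + h *\<^sub>R w) - f (x + h *\<^sub>R v) - f (x + h *\<^sub>R w) + f x =
      h^2 * frechet_derivative (\<lambda>z. frechet_derivative f (at z) v) (at p) w"
proof -
  let ?D = "\<lambda>z. frechet_derivative f (at z)"
  have dist: "dist x (x + s *\<^sub>R v + t *\<^sub>R w) \<le> h * (norm v + norm w)"
    if "0 \<le> s" "s \<le> h" "0 \<le> t" "t \<le> h" for s t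
  proof -
    have "norm (s *\<^sub>R v + t *\<^sub>R w) \<le> norm (s *\<^sub>R v) + norm (t *\<^sub>R w)" by (rule norm_triangle_ineq)
    also have "\<dots> \<le> h * norm v + h * norm w"
      using that by (intro add_mono) (auto intro: mult_right_mono)
    finally show ?thesis
      by (metis add.assoc add_diff_cancel_left' dist_commute dist_norm distrib_left)
  qed
  have inS: "x + s *\<^sub>R v + t *\<^sub>R w \<in> S" "x + s *\<^sub>R v + t *\<^sub>R w \<in> ball x r"
    if "0 \<le> s" "s \<le> h" "0 \<le> t" "t \<le> h" for s t
    using S dist[OF that] h by auto
  \<comment> \<open>\<open>u\<close> is the increment in direction \<open>w\<close>, followed along
    \<open>v\<close>. The second difference is \<open>u h - u 0\<close>; the mean value theorem is
    applied first in \<open>s\<close>, then in \<open>t\<close>.\<close>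
  define u where "u = (\<lambda>s. f (x + s *\<^sub>R v + h *\<^sub>R w) - f (x + s *\<^sub>R v))"
  have du: "(u has_derivative (\<lambda>k. k * (?D (x + s *\<^sub>R v + h *\<^sub>R w) v - ?D (x + s *\<^sub>R v) v))) (at s)"
    if "0 \<le> s" "s \<le> h" for s
  proof -
    have 1: "((\<lambda>s. f (x + s *\<^sub>R v + t *\<^sub>R w)) has_derivative
        (\<lambda>k. ?D (x + s *\<^sub>R v + t *\<^sub>R w) (k *\<^sub>R v))) (at s)" if t: "0 \<le> t" "t \<le> h" for t
      by (rule has_derivative_compose[OF _ smooth_on_has_derivative[OF f]])
        (use inS(1)[OF \<open>0 \<le> s\<close> \<open>s \<le> h\<close> t] in \<open>auto intro!: derivative_eq_intros\<close>)
    have lin: "?D (x + s *\<^sub>R v + t *\<^sub>R w) (k *\<^sub>R v) = k * ?D (x + s *\<^sub>R v + t *\<^sub>R w) v"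
      if t: "0 \<le> t" "t \<le> h" for t k
      using linear_scale[OF linear_frechet_derivative[OF smooth_on_differentiable[OF f]]]
        inS(1)[OF \<open>0 \<le> s\<close> \<open>s \<le> h\<close> t] by fastforce
    show ?thesis
      using has_derivative_diff[OF 1[of h] 1[of 0]] h
      by (simp add: lin[of h] lin[of 0, simplified] u_def right_diff_distrib)
  qed
  obtain s where s: "0 < s" "s < h"
    "u h - u 0 = h * (?D (x + s *\<^sub>R v + h *\<^sub>R w) v - ?D (x + s *\<^sub>R v) v)"
  proof (rule mvt[OF h(1)])
    show "continuous_on {0..h} u"
      using has_derivative_continuous[OF du] by (auto intro!: continuous_at_imp_continuous_on)
    show "(u has_derivative (\<lambda>k. k * (?D (x + s *\<^sub>R v + h *\<^sub>R w) v - ?D (x + s *\<^sub>R v) v))) (at s)"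
      if "0 < s" "s < h" for s using du[of s] that by simp
  qed (simp add: that)
  let ?D2 = "\<lambda>p. frechet_derivative (\<lambda>z. ?D z v) (at p)"
  have d2: "((\<lambda>t. ?D (x + s *\<^sub>R v + t *\<^sub>R w) v) has_derivative
      (\<lambda>k. k * ?D2 (x + s *\<^sub>R v + t *\<^sub>R w) w)) (at t)" if "0 \<le> t" "t \<le> h" for t
  proof -
    have sm: "smooth_on S (\<lambda>z. ?D z v)" using smooth_on_deriv[OF f] .
    have p: "x + s *\<^sub>R v + t *\<^sub>R w \<in> S" using inS(1) s that by simp
    have "((\<lambda>t. ?D (x + s *\<^sub>R v + t *\<^sub>R w) v) has_derivative
      (\<lambda>k. ?D2 (x + s *\<^sub>R v + t *\<^sub>R w) (k *\<^sub>R w))) (at t)"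
      by (rule has_derivative_compose[OF _ smooth_on_has_derivative[OF sm]])
        (use p in \<open>auto intro!: derivative_eq_intros\<close>)
    moreover have "?D2 (x + s *\<^sub>R v + t *\<^sub>R w) (k *\<^sub>R w) = k * ?D2 (x + s *\<^sub>R v + t *\<^sub>R w) w" for k
      using linear_scale[OF linear_frechet_derivative[OF smooth_on_differentiable[OF sm p]]] by simp
    ultimately show ?thesis by simp
  qed
  obtain t where t: "0 < t" "t < h"
    "?D (x + s *\<^sub>R v + h *\<^sub>R w) v - ?D (x + s *\<^sub>R v) v = h * ?D2 (x + s *\<^sub>R v + t *\<^sub>R w) w"
  proof (rule mvt[OF h(1)])
    show "continuous_on {0..h} (\<lambda>t. ?D (x + s *\<^sub>R v + t *\<^sub>R w) v)"
      using has_derivative_continuous[OF d2] by (auto intro!: continuous_at_imp_continuous_on)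
    show "((\<lambda>t. ?D (x + s *\<^sub>R v + t *\<^sub>R w) v) has_derivative
        (\<lambda>k. k * ?D2 (x + s *\<^sub>R v + t *\<^sub>R w) w)) (at t)"
      if "0 < t" "t < h" for t using d2[of t] that by simp
  qed (simp add: that)
  show ?thesis
    using s t dist[of s t] inS(2)[of s t]
    by (intro bexI[of _ "x + s *\<^sub>R v + t *\<^sub>R w"]) (auto simp: u_def power2_eq_square algebra_simps)
qed

text \<open>The second difference does not change when \<open>v\<close> and \<open>w\<close> are
  exchanged. So one mixed derivative at a point \<open>p\<close> equals the other at a point
  \<open>q\<close>, both in an arbitrarily small ball, and continuity does the rest.\<close>

lemma second_derivative_symmetric_real:
  fixes f :: "'v::real_normed_vector \<Rightarrow> real"
  assumes "open S" "smooth_on S f" "x \<in> S"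
  shows "frechet_derivative (\<lambda>z. frechet_derivative f (at z) v) (at x) w =
         frechet_derivative (\<lambda>z. frechet_derivative f (at z) w) (at x) v"
proof (rule ccontr)
  let ?P = "\<lambda>z. frechet_derivative (\<lambda>z. frechet_derivative f (at z) v) (at z) w"
  let ?Q = "\<lambda>z. frechet_derivative (\<lambda>z. frechet_derivative f (at z) w) (at z) v"
  assume neq: "?P x \<noteq> ?Q x"
  \<comment> \<open>Half the gap: two errors below \<open>e\<close> cannot bridge it.\<close>
  define e where "e = \<bar>?P x - ?Q x\<bar> / 2"
  have e: "e > 0" using neq by (simp add: e_def)
  have "continuous_on S ?P" "continuous_on S ?Q"
    using assms(2) by (auto intro!: smooth_on_continuous smooth_on_deriv)
  then have "isCont ?P x" "isCont ?Q x"
    using assms by (auto simp: continuous_on_eq_continuous_at)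
  then obtain d1 d2 where d: "d1 > 0" "\<And>p. dist p x < d1 \<Longrightarrow> dist (?P p) (?P x) < e"
    "d2 > 0" "\<And>p. dist p x < d2 \<Longrightarrow> dist (?Q p) (?Q x) < e"
    unfolding continuous_at_eps_delta dist_norm using e by metis
  obtain r0 where r0: "r0 > 0" "ball x r0 \<subseteq> S" using assms openE by blast
  define r where "r = min r0 (min d1 d2)"
  \<comment> \<open>The \<open>+ 1\<close> keeps the denominator positive when both directions
    vanish.\<close>
  define h where "h = r / (2 * (norm v + norm w + 1))"
  have r: "r > 0" "ball x r \<subseteq> S" using r0 d by (auto simp: r_def)
  have n: "norm v + norm w + 1 > 0" by (simp add: add_nonneg_pos)
  have h: "h > 0" using r n by (simp add: h_def)
  have "h * (norm v + norm w) < h * (2 * (norm v + norm w + 1))"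
    using n by (intro mult_strict_left_mono[OF _ h]) (simp add: algebra_simps)
  also have "\<dots> = r" using n by (simp add: h_def)
  finally have hr: "h * (norm v + norm w) < r" .
  obtain p where p: "p \<in> ball x r"
    "f (x + h *\<^sub>R v + h *\<^sub>R w) - f (x + h *\<^sub>R v) - f (x + h *\<^sub>R w) + f x = h^2 * ?P p"
    using second_difference[OF r(2) assms(2) h hr] by blast
  obtain q where q: "q \<in> ball x r"
    "f (x + h *\<^sub>R w + h *\<^sub>R v) - f (x + h *\<^sub>R w) - f (x + h *\<^sub>R v) + f x = h^2 * ?Q q"
    using second_difference[OF r(2) assms(2) h hr[unfolded add.commute[of "norm v"]]] by blast
  have "h^2 * ?P p = h^2 * ?Q q" using p(2) q(2) by (simp add: algebra_simps)
  then have "?P p = ?Q q" using h by simp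
  moreover have "dist (?P p) (?P x) < e" "dist (?Q q) (?Q x) < e"
    using p(1) q(1) by (auto intro!: d(2,4) simp: r_def dist_commute)
  ultimately show False unfolding e_def dist_real_def by (auto simp: abs_if split: if_splits)
qed

lemma frechet_derivative_inner:
  "f differentiable at x \<Longrightarrow>
     frechet_derivative (\<lambda>z. f z \<bullet> b) (at x) v = frechet_derivative f (at x) v \<bullet> b"
  by (intro frechet_derivative_eqI has_derivative_inner_left has_frechet_derivative)

lemma second_derivative_symmetric:
  fixes f :: "'v::real_normed_vector \<Rightarrow> 'w::euclidean_space"
  assumes S: "open S" and f: "smooth_on S f" and x: "x \<in> S"
  shows "frechet_derivative (\<lambda>z. frechet_derivative f (at z) v) (at x) w =
         frechet_derivative (\<lambda>z. frechet_derivative f (at z) w) (at x) v"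
proof (rule euclidean_eqI)
  fix b :: 'w assume "b \<in> Basis"
  have fb: "smooth_on S (\<lambda>z. f z \<bullet> b)"
    by (rule smooth_on_bounded_linear[OF S bounded_linear_inner_left f])
  have *: "frechet_derivative (\<lambda>z. frechet_derivative f (at z) v) (at x) w \<bullet> b =
      frechet_derivative (\<lambda>z. frechet_derivative (\<lambda>z. f z \<bullet> b) (at z) v) (at x) w" for v w
  proof -
    have "frechet_derivative (\<lambda>z. frechet_derivative (\<lambda>z. f z \<bullet> b) (at z) v) (at x) w =
        frechet_derivative (\<lambda>z. frechet_derivative f (at z) v \<bullet> b) (at x) w"
      using frechet_derivative_cong_open[OF S x, of "\<lambda>z. frechet_derivative (\<lambda>z. f z \<bullet> b) (at z) v"
          "\<lambda>z. frechet_derivative f (at z) v \<bullet> b"]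
        frechet_derivative_inner[OF smooth_on_differentiable[OF f]] by simp
    then show ?thesis
      by (simp add: frechet_derivative_inner[OF smooth_on_differentiable[OF smooth_on_deriv[OF f] x]])
  qed
  show "frechet_derivative (\<lambda>z. frechet_derivative f (at z) v) (at x) w \<bullet> b =
      frechet_derivative (\<lambda>z. frechet_derivative f (at z) w) (at x) v \<bullet> b"
    using * second_derivative_symmetric_real[OF S fb x] by simp
qed

text \<open>Product rule for a direction that varies with the point. The first term freezes the
  direction at \<open>Y x\<close>, which is the form to which the symmetry of second derivatives
  applies.\<close>

lemma dderiv_deriv:
  fixes f :: "'v::euclidean_space \<Rightarrow> 'w::real_normed_vector"
  assumes S: "open S" and f: "smooth_on S f" and Y: "smooth_on S Y" and x: "x \<in> S"
  shows "frechet_derivative (dderiv Y f) (at x) w =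
    frechet_derivative (\<lambda>z. frechet_derivative f (at z) (Y x)) (at x) w +
    frechet_derivative f (at x) (frechet_derivative Y (at x) w)"
proof -
  let ?D = "\<lambda>z. frechet_derivative f (at z)"
  have df: "f differentiable at z" if "z \<in> S" for z using smooth_on_differentiable[OF f that] .
  have ds: "((\<lambda>z. ?D z b) has_derivative (\<lambda>w. frechet_derivative (\<lambda>z. ?D z b) (at x) w)) (at x)" for b
    using smooth_on_has_derivative[OF smooth_on_deriv[OF f] x] .
  have "(dderiv Y f has_derivative (\<lambda>w. \<Sum>b\<in>Basis.
      (Y x \<bullet> b) *\<^sub>R frechet_derivative (\<lambda>z. ?D z b) (at x) w + (frechet_derivative Y (at x) w \<bullet> b) *\<^sub>R ?D x b)) (at x)"
  proof (rule has_derivative_cong_open[OF S x, THEN iffD2])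
    show "((\<lambda>y. \<Sum>b\<in>Basis. (Y y \<bullet> b) *\<^sub>R ?D y b) has_derivative (\<lambda>w. \<Sum>b\<in>Basis.
      (Y x \<bullet> b) *\<^sub>R frechet_derivative (\<lambda>z. ?D z b) (at x) w + (frechet_derivative Y (at x) w \<bullet> b) *\<^sub>R ?D x b)) (at x)"
      by (intro has_derivative_sum has_derivative_scaleR has_derivative_inner_left ds
          smooth_on_has_derivative[OF Y x])
  qed (simp add: dderiv_def frechet_derivative_euclidean[OF df])
  then have 1: "frechet_derivative (dderiv Y f) (at x) w = (\<Sum>b\<in>Basis.
      (Y x \<bullet> b) *\<^sub>R frechet_derivative (\<lambda>z. ?D z b) (at x) w) +
      (\<Sum>b\<in>Basis. (frechet_derivative Y (at x) w \<bullet> b) *\<^sub>R ?D x b)"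
    by (simp add: frechet_derivative_eqI sum.distrib)
  have "((\<lambda>z. ?D z (Y x)) has_derivative (\<lambda>w. \<Sum>b\<in>Basis.
      (Y x \<bullet> b) *\<^sub>R frechet_derivative (\<lambda>z. ?D z b) (at x) w)) (at x)"
  proof (rule has_derivative_cong_open[OF S x, THEN iffD2])
    show "((\<lambda>y. \<Sum>b\<in>Basis. (Y x \<bullet> b) *\<^sub>R ?D y b) has_derivative (\<lambda>w. \<Sum>b\<in>Basis.
      (Y x \<bullet> b) *\<^sub>R frechet_derivative (\<lambda>z. ?D z b) (at x) w)) (at x)"
      by (intro has_derivative_sum has_derivative_scaleR_right ds)
  qed (rule frechet_derivative_euclidean[OF df])
  then have "frechet_derivative (\<lambda>z. ?D z (Y x)) (at x) w = (\<Sum>b\<in>Basis.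
      (Y x \<bullet> b) *\<^sub>R frechet_derivative (\<lambda>z. ?D z b) (at x) w)"
    by (rule frechet_derivative_eqI)
  with 1 show ?thesis using frechet_derivative_euclidean[OF df[OF x]] by metis
qed

lemma dderiv_commutator:
  fixes f :: "'v::euclidean_space \<Rightarrow> 'w::euclidean_space"
  assumes S: "open S" and f: "smooth_on S f" and X: "smooth_on S X" and Y: "smooth_on S Y" and x: "x \<in> S"
  shows "dderiv X (dderiv Y f) x - dderiv Y (dderiv X f) x =
    frechet_derivative f (at x) (dderiv X Y x - dderiv Y X x)"
proof -
  have lin: "linear (frechet_derivative f (at x))"
    using linear_frechet_derivative[OF smooth_on_differentiable[OF f x]] .
  show ?thesis
    unfolding linear_diff[OF lin]
    unfolding dderiv_def[of X "dderiv Y f"] dderiv_def[of Y "dderiv X f"]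
      dderiv_deriv[OF S f X x] dderiv_deriv[OF S f Y x]
    using second_derivative_symmetric[OF S f x, of "X x" "Y x"] by (simp add: dderiv_def)
qed

lemma dderiv_cong_open:
  assumes "open S" "x \<in> S" "\<And>y. y \<in> S \<Longrightarrow> f y = g y" "X x = Y x"
  shows "dderiv X f x = dderiv Y g x"
  unfolding dderiv_def using frechet_derivative_cong_open[OF assms(1-3)] assms(4) by simp

section \<open>Vector fields on an atlas\<close>

abbreviation (input) loc :: "('a, 'v) vfield \<Rightarrow> ('a, 'v) chart \<Rightarrow> 'v \<Rightarrow> 'v" where
  "loc X c \<equiv> \<lambda>x. X (chart_inv c x) c"

lemma mk_field_apply [simp]: "c \<in> B \<Longrightarrow> p \<in> dom_of c \<Longrightarrow> mk_field B \<Phi> p c = \<Phi> p c"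
  by (auto simp: mk_field_def carrier_of_def charts_at_def)

lemma vf_zero_apply [simp]: "c \<in> B \<Longrightarrow> p \<in> dom_of c \<Longrightarrow> vf_zero B p c = 0"
  by (simp add: vf_zero_def)

lemma vf_add_apply [simp]: "c \<in> B \<Longrightarrow> p \<in> dom_of c \<Longrightarrow> vf_add B X Y p c = X p c + Y p c"
  by (simp add: vf_add_def)

lemma vf_diff_apply [simp]: "c \<in> B \<Longrightarrow> p \<in> dom_of c \<Longrightarrow> vf_diff B X Y p c = X p c - Y p c"
  by (simp add: vf_diff_def)

lemma vf_scale_apply [simp]: "c \<in> B \<Longrightarrow> p \<in> dom_of c \<Longrightarrow> vf_scale B f X p c = f p *\<^sub>R X p c"
  by (simp add: vf_scale_def)

text \<open>The extensionality part of being a vector field. Every \<open>mk_field\<close>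
  construction has it, so identities between such fields can be checked on chart components before
  smoothness is known.\<close>

definition ext_field :: "('a, 'v) chart set \<Rightarrow> ('a, 'v) vfield \<Rightarrow> bool" where
  "ext_field B X \<longleftrightarrow> X \<in> extensional (carrier_of B) \<and>
     (\<forall>p\<in>carrier_of B. X p \<in> extensional (charts_at B p))"

lemma ext_field_mk_field: "ext_field B (mk_field B \<Phi>)"
  by (auto simp: ext_field_def mk_field_def)

lemma ext_field_simps [simp]:
  "ext_field B (vf_zero B)" "ext_field B (vf_add B X Y)" "ext_field B (vf_diff B X Y)"
  "ext_field B (vf_scale B f X)" "ext_field B (bracket B X Y)"
  by (auto simp: vf_zero_def vf_add_def vf_diff_def vf_scale_def bracket_def ext_field_mk_field)

lemma ext_field_vector_fields [simp]: "X \<in> vector_fields B \<Longrightarrow> ext_field B X"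
  by (auto simp: ext_field_def vector_fields_def tangent_space_def)

lemma ext_field_eqI:
  assumes "ext_field B X" "ext_field B Y"
    "\<And>p c. c \<in> B \<Longrightarrow> p \<in> dom_of c \<Longrightarrow> X p c = Y p c"
  shows "X = Y"
proof (rule extensionalityI)
  show "X \<in> extensional (carrier_of B)" "Y \<in> extensional (carrier_of B)"
    using assms by (auto simp: ext_field_def)
  show "X p = Y p" if "p \<in> carrier_of B" for p
  proof (rule extensionalityI)
    show "X p \<in> extensional (charts_at B p)" "Y p \<in> extensional (charts_at B p)"
      using assms(1,2) that by (auto simp: ext_field_def)
  qed (use assms(3) in \<open>auto simp: charts_at_def\<close>)
qed

text \<open>The analytic content of a smooth manifold, with no topology on the carrier. The same
  locale thus serves the base and the slit bundle, on which no topology is ever defined.\<close>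

locale smooth_atlas =
  fixes B :: "('a, 'v::euclidean_space) chart set"
  assumes inj: "c \<in> B \<Longrightarrow> inj_on (snd c) (dom_of c)"
    and open_range: "c \<in> B \<Longrightarrow> open (range_of c)"
    and open_overlap: "c \<in> B \<Longrightarrow> d \<in> B \<Longrightarrow> open (snd c ` (dom_of c \<inter> dom_of d))"
    and smooth_transition:
      "c \<in> B \<Longrightarrow> d \<in> B \<Longrightarrow> smooth_on (snd c ` (dom_of c \<inter> dom_of d)) (transition c d)"
begin

abbreviation "\<XX> \<equiv> vector_fields B"
abbreviation "\<FF> \<equiv> smooth_functions B"

lemma chart_inv_chart [simp]: "c \<in> B \<Longrightarrow> p \<in> dom_of c \<Longrightarrow> chart_inv c (snd c p) = p"
  using inj by (simp add: chart_inv_def)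

lemma chart_in_range [simp]: "p \<in> dom_of c \<Longrightarrow> snd c p \<in> range_of c"
  by (simp add: range_of_def)

lemma chart_inv_dom [simp]: "x \<in> range_of c \<Longrightarrow> chart_inv c x \<in> dom_of c"
  by (auto simp: range_of_def chart_inv_def intro: inv_into_into)

lemma chart_chart_inv [simp]: "x \<in> range_of c \<Longrightarrow> snd c (chart_inv c x) = x"
  by (auto simp: range_of_def chart_inv_def f_inv_into_f)

lemma transition_apply [simp]:
  "c \<in> B \<Longrightarrow> p \<in> dom_of c \<Longrightarrow> transition c d (snd c p) = snd d p"
  by (simp add: transition_def)

lemma carrierE:
  assumes "p \<in> carrier_of B" obtains c where "c \<in> B" "p \<in> dom_of c"
  using assms by (auto simp: carrier_of_def)

lemma in_carrier: "c \<in> B \<Longrightarrow> p \<in> dom_of c \<Longrightarrow> p \<in> carrier_of B"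
  by (auto simp: carrier_of_def)

lemma transition_deriv:
  assumes "c \<in> B" "d \<in> B" "p \<in> dom_of c" "p \<in> dom_of d"
  shows "(transition c d has_derivative (\<lambda>w. frechet_derivative (transition c d) (at (snd c p)) w)) (at (snd c p))"
  using smooth_on_has_derivative[OF smooth_transition] assms by blast

lemma vector_fields_smooth: "X \<in> \<XX> \<Longrightarrow> c \<in> B \<Longrightarrow> smooth_on (range_of c) (loc X c)"
  by (simp add: vector_fields_def)

lemma vector_fields_transform:
  "X \<in> \<XX> \<Longrightarrow> c \<in> B \<Longrightarrow> d \<in> B \<Longrightarrow> p \<in> dom_of c \<Longrightarrow> p \<in> dom_of d \<Longrightarrow>
     X p d = frechet_derivative (transition c d) (at (snd c p)) (X p c)"
  unfolding vector_fields_def tangent_space_def charts_at_def carrier_of_def by blast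

lemma smooth_functionD: "f \<in> \<FF> \<Longrightarrow> c \<in> B \<Longrightarrow> smooth_on (range_of c) (f \<circ> chart_inv c)"
  by (simp add: smooth_functions_def)

lemma mk_field_in:
  assumes "\<And>p c d. c \<in> B \<Longrightarrow> d \<in> B \<Longrightarrow> p \<in> dom_of c \<Longrightarrow> p \<in> dom_of d \<Longrightarrow>
      \<Phi> p d = frechet_derivative (transition c d) (at (snd c p)) (\<Phi> p c)"
    and "\<And>c. c \<in> B \<Longrightarrow> smooth_on (range_of c) (\<lambda>x. \<Phi> (chart_inv c x) c)"
  shows "mk_field B \<Phi> \<in> \<XX>"
proof -
  have "mk_field B \<Phi> p \<in> tangent_space B p" if "p \<in> carrier_of B" for p
    using ext_field_mk_field[of B \<Phi>] that assms(1)
    by (simp add: tangent_space_def ext_field_def charts_at_def del: split_paired_All)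
  moreover have "smooth_on (range_of c) (loc (mk_field B \<Phi>) c)" if "c \<in> B" for c
    using smooth_on_cong[OF open_range[OF that], of "loc (mk_field B \<Phi>) c" "\<lambda>x. \<Phi> (chart_inv c x) c"]
      assms(2) that by simp
  ultimately show ?thesis
    using ext_field_mk_field[of B \<Phi>] by (simp add: vector_fields_def ext_field_def)
qed

lemma linear_transition:
  assumes "c \<in> B" "d \<in> B" "p \<in> dom_of c" "p \<in> dom_of d"
  shows "linear (frechet_derivative (transition c d) (at (snd c p)))"
  using transition_deriv[OF assms] has_derivative_linear by blast

lemma vf_zero_in [simp]: "vf_zero B \<in> \<XX>"
  unfolding vf_zero_def
  by (rule mk_field_in) (simp_all add: linear_0[OF linear_transition] smooth_on_const)

lemma vf_add_in [simp]: "X \<in> \<XX> \<Longrightarrow> Y \<in> \<XX> \<Longrightarrow> vf_add B X Y \<in> \<XX>"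
  unfolding vf_add_def
  by (rule mk_field_in)
    (simp_all add: linear_add[OF linear_transition] vector_fields_transform[symmetric]
      smooth_on_add[OF open_range] vector_fields_smooth)

lemma vf_diff_in [simp]: "X \<in> \<XX> \<Longrightarrow> Y \<in> \<XX> \<Longrightarrow> vf_diff B X Y \<in> \<XX>"
  unfolding vf_diff_def
  by (rule mk_field_in)
    (simp_all add: linear_diff[OF linear_transition] vector_fields_transform[symmetric]
      smooth_on_diff[OF open_range] vector_fields_smooth)

lemma vf_scale_in [simp]: "f \<in> \<FF> \<Longrightarrow> X \<in> \<XX> \<Longrightarrow> vf_scale B f X \<in> \<XX>"
  unfolding vf_scale_def
  by (rule mk_field_in)
    (simp_all add: linear_scale[OF linear_transition] vector_fields_transform[symmetric]
      smooth_on_scaleR[OF open_range] vector_fields_smooth smooth_functionD[unfolded comp_def])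

lemma const_in [simp]: "(\<lambda>p. a) \<in> \<FF>"
  by (simp add: smooth_functions_def comp_def smooth_on_const)

section \<open>Independence of the chart, and the action of fields on functions\<close>

lemma loc_cong:
  assumes "c \<in> B" "p \<in> dom_of c" "\<And>q. q \<in> dom_of c \<Longrightarrow> F q = G q"
  shows "frechet_derivative (\<lambda>x. F (chart_inv c x)) (at (snd c p)) =
    frechet_derivative (\<lambda>x. G (chart_inv c x)) (at (snd c p))"
  by (rule frechet_derivative_cong_open[OF open_range[OF assms(1)]]) (use assms in auto)

lemma bracket_eq:
  assumes "c \<in> B" "p \<in> dom_of c"
  shows "bracket B X Y p c = dderiv (loc X c) (loc Y c) (snd c p) - dderiv (loc Y c) (loc X c) (snd c p)"
  using assms by (simp add: bracket_def dderiv_def)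

lemma loc_bracket:
  assumes "c \<in> B" "x \<in> range_of c"
  shows "loc (bracket B X Y) c x = dderiv (loc X c) (loc Y c) x - dderiv (loc Y c) (loc X c) x"
  using bracket_eq[OF assms(1) chart_inv_dom[OF assms(2)]] assms(2) by simp

text \<open>Chain rule across a transition, on the overlap of two charts. It underlies the chart
  independence of \<open>X f\<close>, the transformation law of the bracket and the cocycle rule for
  transitions.\<close>

lemma transition_comp_deriv:
  assumes c: "c \<in> B" "d \<in> B" and p: "p \<in> dom_of c" "p \<in> dom_of d"
    and diff: "(\<lambda>x. F (chart_inv d x)) differentiable at (snd d p)"
    and eq: "\<And>q. q \<in> dom_of c \<Longrightarrow> q \<in> dom_of d \<Longrightarrow> G q = F q"
  shows "((\<lambda>x. G (chart_inv c x)) has_derivative (\<lambda>w. frechet_derivative (\<lambda>x. F (chart_inv d x)) (at (snd d p))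
    (frechet_derivative (transition c d) (at (snd c p)) w))) (at (snd c p))"
proof (rule has_derivative_cong_open[OF open_overlap[OF c], THEN iffD2])
  show "snd c p \<in> snd c ` (dom_of c \<inter> dom_of d)" using p by auto
  show "((\<lambda>x. F (chart_inv d (transition c d x))) has_derivative
     (\<lambda>w. frechet_derivative (\<lambda>x. F (chart_inv d x)) (at (snd d p))
           (frechet_derivative (transition c d) (at (snd c p)) w))) (at (snd c p))"
    using has_derivative_compose[OF transition_deriv[OF c p], of "\<lambda>x. F (chart_inv d x)"]
      has_frechet_derivative[OF diff] c p by simp
  show "G (chart_inv c x) = F (chart_inv d (transition c d x))"
    if "x \<in> snd c ` (dom_of c \<inter> dom_of d)" for x using that c eq by auto
qed

text \<open>\<open>vf_apply\<close> works in an arbitrarily chosen chart, here \<open>d\<close>;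
  this lemma frees every later computation from that choice.\<close>

lemma vf_apply_eq:
  assumes X: "X \<in> \<XX>" and f: "f \<in> \<FF>" and c: "c \<in> B" "p \<in> dom_of c"
  shows "vf_apply B X f p = dderiv (loc X c) (f \<circ> chart_inv c) (snd c p)"
proof -
  define d where "d = (SOME d. d \<in> charts_at B p)"
  have "d \<in> charts_at B p" unfolding d_def by (rule someI[of _ c]) (use c in \<open>simp add: charts_at_def\<close>)
  then have d: "d \<in> B" "p \<in> dom_of d" by (auto simp: charts_at_def)
  have "(f \<circ> chart_inv d) differentiable at (snd d p)"
    using smooth_on_differentiable[OF smooth_functionD[OF f d(1)]] d by simp
  then have "frechet_derivative (\<lambda>x. f (chart_inv c x)) (at (snd c p)) (X p c) =
      frechet_derivative (\<lambda>x. f (chart_inv d x)) (at (snd d p)) (X p d)"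
    using frechet_derivative_eqI[OF transition_comp_deriv[OF c(1) d(1) c(2) d(2), of f f]]
      vector_fields_transform[OF X c(1) d(1) c(2) d(2)] by (simp add: comp_def)
  then show ?thesis using c
    by (simp add: vf_apply_def Let_def d_def[symmetric] dderiv_def comp_def)
qed

text \<open>Both sides use the same chosen chart, so the comparison works for arbitrary functions.
  It is applied to \<open>metric\<close>, which is identified with \<open>\<Omega>\<close> only on
  the carrier.\<close>

lemma vf_apply_cong:
  assumes "\<And>q. q \<in> carrier_of B \<Longrightarrow> f q = g q" "p \<in> carrier_of B" "X p = Y p"
  shows "vf_apply B X f p = vf_apply B Y g p"
proof -
  define d where "d = (SOME d. d \<in> charts_at B p)"
  have "\<exists>c. c \<in> charts_at B p" using assms(2) by (auto simp: charts_at_def carrier_of_def)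
  then have "d \<in> charts_at B p" unfolding d_def by (rule someI_ex)
  then have d: "d \<in> B" "p \<in> dom_of d" by (auto simp: charts_at_def)
  have "frechet_derivative (f \<circ> chart_inv d) (at (snd d p)) = frechet_derivative (g \<circ> chart_inv d) (at (snd d p))"
    unfolding comp_def by (rule loc_cong[OF d]) (use assms(1) d in_carrier in blast)
  then show ?thesis by (simp add: vf_apply_def Let_def d_def[symmetric] assms(3))
qed

lemma vf_apply_in [simp]:
  assumes X: "X \<in> \<XX>" and f: "f \<in> \<FF>" shows "vf_apply B X f \<in> \<FF>"
proof -
  have "smooth_on (range_of c) (vf_apply B X f \<circ> chart_inv c)" if c: "c \<in> B" for c
    using smooth_on_dderiv[OF open_range[OF c] smooth_functionD[OF f c] vector_fields_smooth[OF X c]]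
      smooth_on_cong[OF open_range[OF c], of "vf_apply B X f \<circ> chart_inv c" "dderiv (loc X c) (f \<circ> chart_inv c)"]
      vf_apply_eq[OF X f c] by simp
  then show ?thesis by (simp add: smooth_functions_def)
qed

lemma diff_in [simp]: "f \<in> \<FF> \<Longrightarrow> g \<in> \<FF> \<Longrightarrow> (\<lambda>p. f p - g p) \<in> \<FF>"
  by (auto simp: smooth_functions_def comp_def intro!: smooth_on_diff[OF open_range])

lemma linear_loc_deriv:
  "f \<in> \<FF> \<Longrightarrow> c \<in> B \<Longrightarrow> p \<in> dom_of c \<Longrightarrow> linear (frechet_derivative (f \<circ> chart_inv c) (at (snd c p)))"
  by (intro linear_frechet_derivative smooth_on_differentiable[OF smooth_functionD]) auto

lemma vf_apply_add:
  assumes "X \<in> \<XX>" "Y \<in> \<XX>" "f \<in> \<FF>" "p \<in> carrier_of B"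
  shows "vf_apply B (vf_add B X Y) f p = vf_apply B X f p + vf_apply B Y f p"
proof -
  obtain c where "c \<in> B" "p \<in> dom_of c" using assms(4) by (rule carrierE)
  then show ?thesis
    using assms by (simp add: vf_apply_eq[of _ _ c] dderiv_def linear_add[OF linear_loc_deriv])
qed

lemma vf_apply_diff:
  assumes "X \<in> \<XX>" "Y \<in> \<XX>" "f \<in> \<FF>" "p \<in> carrier_of B"
  shows "vf_apply B (vf_diff B X Y) f p = vf_apply B X f p - vf_apply B Y f p"
proof -
  obtain c where "c \<in> B" "p \<in> dom_of c" using assms(4) by (rule carrierE)
  then show ?thesis
    using assms by (simp add: vf_apply_eq[of _ _ c] dderiv_def linear_diff[OF linear_loc_deriv])
qed

lemma vf_apply_zero:
  assumes "f \<in> \<FF>" "p \<in> carrier_of B"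
  shows "vf_apply B (vf_zero B) f p = 0"
proof -
  obtain c where "c \<in> B" "p \<in> dom_of c" using assms(2) by (rule carrierE)
  then show ?thesis
    using assms by (simp add: vf_apply_eq[of _ _ c] dderiv_def linear_0[OF linear_loc_deriv])
qed

lemma vf_apply_fun_diff:
  assumes "X \<in> \<XX>" "f \<in> \<FF>" "g \<in> \<FF>" "p \<in> carrier_of B"
  shows "vf_apply B X (\<lambda>q. f q - g q) p = vf_apply B X f p - vf_apply B X g p"
proof -
  obtain c where c: "c \<in> B" "p \<in> dom_of c" using assms(4) by (rule carrierE)
  have "((\<lambda>x. (f \<circ> chart_inv c) x - (g \<circ> chart_inv c) x) has_derivative (\<lambda>w.
      frechet_derivative (f \<circ> chart_inv c) (at (snd c p)) w - frechet_derivative (g \<circ> chart_inv c) (at (snd c p)) w))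
      (at (snd c p))"
    using c by (intro has_derivative_diff smooth_on_has_derivative[OF smooth_functionD] assms) auto
  from frechet_derivative_eqI[OF this] show ?thesis
    using assms c by (simp add: vf_apply_eq[of _ _ c] dderiv_def comp_def)
qed

lemma vf_apply_zero_fun:
  assumes "\<And>q. q \<in> carrier_of B \<Longrightarrow> f q = 0" "p \<in> carrier_of B"
  shows "vf_apply B X f p = 0"
proof -
  have "vf_apply B X f p = vf_apply B X (\<lambda>q. 0) p" using assms by (intro vf_apply_cong) auto
  then show ?thesis by (simp add: vf_apply_def comp_def)
qed

lemma dderiv_loc_add:
  assumes "X \<in> \<XX>" "Y \<in> \<XX>" "c \<in> B" "p \<in> dom_of c"
  shows "dderiv Z (loc (vf_add B X Y) c) (snd c p) = dderiv Z (loc X c) (snd c p) + dderiv Z (loc Y c) (snd c p)"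
proof -
  have "frechet_derivative (loc (vf_add B X Y) c) (at (snd c p)) =
      frechet_derivative (\<lambda>x. X (chart_inv c x) c + Y (chart_inv c x) c) (at (snd c p))"
    using loc_cong[OF assms(3,4), of "\<lambda>q. vf_add B X Y q c" "\<lambda>q. X q c + Y q c"] assms(3) by simp
  then show ?thesis unfolding dderiv_def using assms
    by (auto intro!: frechet_derivative_eqI has_derivative_add smooth_on_has_derivative[OF vector_fields_smooth])
qed

lemma dderiv_loc_scale:
  assumes "X \<in> \<XX>" "f \<in> \<FF>" "c \<in> B" "p \<in> dom_of c"
  shows "dderiv Z (loc (vf_scale B f X) c) (snd c p) =
    f p *\<^sub>R dderiv Z (loc X c) (snd c p) + dderiv Z (f \<circ> chart_inv c) (snd c p) *\<^sub>R X p c"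
proof -
  have 1: "frechet_derivative (loc (vf_scale B f X) c) (at (snd c p)) =
      frechet_derivative (\<lambda>x. f (chart_inv c x) *\<^sub>R X (chart_inv c x) c) (at (snd c p))"
    using loc_cong[OF assms(3,4), of "\<lambda>q. vf_scale B f X q c" "\<lambda>q. f q *\<^sub>R X q c"] assms(3) by simp
  have "((\<lambda>x. (f \<circ> chart_inv c) x *\<^sub>R X (chart_inv c x) c) has_derivative (\<lambda>w.
      (f \<circ> chart_inv c) (snd c p) *\<^sub>R frechet_derivative (loc X c) (at (snd c p)) w +
      frechet_derivative (f \<circ> chart_inv c) (at (snd c p)) w *\<^sub>R X (chart_inv c (snd c p)) c)) (at (snd c p))"
    using assms
    by (intro has_derivative_scaleR smooth_on_has_derivative[OF vector_fields_smooth]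
        smooth_on_has_derivative[OF smooth_functionD]) auto
  from frechet_derivative_eqI[OF this] show ?thesis unfolding dderiv_def 1 using assms by simp
qed

section \<open>Lie brackets\<close>

lemma bracket_antisym:
  "c \<in> B \<Longrightarrow> p \<in> dom_of c \<Longrightarrow> bracket B X Y p c = - bracket B Y X p c"
  by (simp add: bracket_eq)

lemma linear_loc:
  "X \<in> \<XX> \<Longrightarrow> c \<in> B \<Longrightarrow> p \<in> dom_of c \<Longrightarrow> linear (frechet_derivative (loc X c) (at (snd c p)))"
  by (intro linear_frechet_derivative smooth_on_differentiable[OF vector_fields_smooth]) auto

lemma bracket_add_left:
  assumes "X \<in> \<XX>" "Y \<in> \<XX>" "Z \<in> \<XX>"
  shows "bracket B (vf_add B X Y) Z = vf_add B (bracket B X Z) (bracket B Y Z)"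
proof (rule ext_field_eqI[of B])
  fix p c assume c: "c \<in> B" "p \<in> dom_of c"
  have "dderiv (loc (vf_add B X Y) c) (loc Z c) (snd c p) =
      dderiv (loc X c) (loc Z c) (snd c p) + dderiv (loc Y c) (loc Z c) (snd c p)"
    using c by (simp add: dderiv_def linear_add[OF linear_loc[OF assms(3)]])
  then show "bracket B (vf_add B X Y) Z p c = vf_add B (bracket B X Z) (bracket B Y Z) p c"
    using c assms by (simp add: bracket_eq dderiv_loc_add)
qed auto

lemma bracket_scale_left:
  assumes "X \<in> \<XX>" "f \<in> \<FF>" "Y \<in> \<XX>"
  shows "bracket B (vf_scale B f X) Y = vf_diff B (vf_scale B f (bracket B X Y)) (vf_scale B (vf_apply B Y f) X)"
proof (rule ext_field_eqI[of B])
  fix p c assume c: "c \<in> B" "p \<in> dom_of c"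
  have "dderiv (loc (vf_scale B f X) c) (loc Y c) (snd c p) = f p *\<^sub>R dderiv (loc X c) (loc Y c) (snd c p)"
    using c by (simp add: dderiv_def linear_scale[OF linear_loc[OF assms(3)]])
  then show "bracket B (vf_scale B f X) Y p c =
      vf_diff B (vf_scale B f (bracket B X Y)) (vf_scale B (vf_apply B Y f) X) p c"
    using c assms by (simp add: bracket_eq dderiv_loc_scale vf_apply_eq[of _ _ c] scaleR_diff_right)
qed auto

text \<open>The components of \<open>Z\<close> in chart \<open>d\<close>, read in chart
  \<open>c\<close>, are the derivative of the transition map along \<open>Z\<close>. The
  transformation law is therefore the commutator rule applied to the transition map.\<close>

lemma bracket_in [simp]:
  assumes X: "X \<in> \<XX>" and Y: "Y \<in> \<XX>" shows "bracket B X Y \<in> \<XX>"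
  unfolding bracket_def
proof (rule mk_field_in)
  fix c assume c: "c \<in> B"
  have "smooth_on (range_of c) (\<lambda>x. dderiv (loc X c) (loc Y c) x - dderiv (loc Y c) (loc X c) x)"
    using c assms by (intro smooth_on_diff smooth_on_dderiv open_range vector_fields_smooth)
  then show "smooth_on (range_of c) (\<lambda>x.
      frechet_derivative (loc Y c) (at (snd c (chart_inv c x))) (X (chart_inv c x) c) -
      frechet_derivative (loc X c) (at (snd c (chart_inv c x))) (Y (chart_inv c x) c))"
    by (subst smooth_on_cong[OF open_range[OF c]]) (auto simp: dderiv_def)
next
  fix p c d assume c: "c \<in> B" "d \<in> B" and p: "p \<in> dom_of c" "p \<in> dom_of d"
  let ?O = "snd c ` (dom_of c \<inter> dom_of d)"
  let ?t = "transition c d"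
  have sub: "?O \<subseteq> range_of c" by (auto simp: range_of_def)
  have sm: "smooth_on ?O (loc Z c)" if "Z \<in> \<XX>" for Z
    using smooth_on_subset[OF vector_fields_smooth[OF that c(1)] sub] .
  have main: "frechet_derivative (loc Z d) (at (snd d p)) (W p d) =
      dderiv (loc W c) (dderiv (loc Z c) ?t) (snd c p)" if Z: "Z \<in> \<XX>" and W: "W \<in> \<XX>" for Z W
  proof -
    have "frechet_derivative (dderiv (loc Z c) ?t) (at (snd c p)) =
        frechet_derivative (\<lambda>x. Z (chart_inv c x) d) (at (snd c p))"
    proof (rule frechet_derivative_cong_open[OF open_overlap[OF c]])
      show "snd c p \<in> ?O" using p by auto
      show "dderiv (loc Z c) ?t y = Z (chart_inv c y) d" if "y \<in> ?O" for y
        using that vector_fields_transform[OF Z c] c by (auto simp: dderiv_def)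
    qed
    moreover have "frechet_derivative (\<lambda>x. Z (chart_inv c x) d) (at (snd c p)) w =
        frechet_derivative (loc Z d) (at (snd d p)) (frechet_derivative ?t (at (snd c p)) w)" for w
      by (rule frechet_derivative_eqI[OF transition_comp_deriv[OF c p, where F = "\<lambda>q. Z q d"]])
        (use smooth_on_differentiable[OF vector_fields_smooth[OF Z c(2)]] p in auto)
    ultimately show ?thesis
      using vector_fields_transform[OF W c p] c p by (simp add: dderiv_def)
  qed
  have "dderiv (loc X c) (dderiv (loc Y c) ?t) (snd c p) - dderiv (loc Y c) (dderiv (loc X c) ?t) (snd c p) =
      frechet_derivative ?t (at (snd c p)) (dderiv (loc X c) (loc Y c) (snd c p) - dderiv (loc Y c) (loc X c) (snd c p))"
    using p by (intro dderiv_commutator[OF open_overlap[OF c]] smooth_transition c sm X Y) auto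
  then show "frechet_derivative (loc Y d) (at (snd d p)) (X p d) - frechet_derivative (loc X d) (at (snd d p)) (Y p d) =
      frechet_derivative ?t (at (snd c p))
       (frechet_derivative (loc Y c) (at (snd c p)) (X p c) - frechet_derivative (loc X c) (at (snd c p)) (Y p c))"
    using main[OF X Y] main[OF Y X] c p by (simp add: dderiv_def)
qed

lemma dderiv_loc_bracket:
  assumes X: "X \<in> \<XX>" and Y: "Y \<in> \<XX>" and c: "c \<in> B" "p \<in> dom_of c"
  shows "dderiv Z (loc (bracket B X Y) c) (snd c p) =
    dderiv Z (dderiv (loc X c) (loc Y c)) (snd c p) - dderiv Z (dderiv (loc Y c) (loc X c)) (snd c p)"
proof -
  have sm: "smooth_on (range_of c) (dderiv (loc X c) (loc Y c))" "smooth_on (range_of c) (dderiv (loc Y c) (loc X c))"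
    using assms by (auto intro!: smooth_on_dderiv open_range vector_fields_smooth)
  have "frechet_derivative (loc (bracket B X Y) c) (at (snd c p)) =
      frechet_derivative (\<lambda>x. dderiv (loc X c) (loc Y c) x - dderiv (loc Y c) (loc X c) x) (at (snd c p))"
    by (rule frechet_derivative_cong_open[OF open_range[OF c(1)]]) (use c loc_bracket in auto)
  then show ?thesis unfolding dderiv_def[of Z] using c
    by (auto intro!: frechet_derivative_eqI has_derivative_diff smooth_on_has_derivative[OF sm(1)]
        smooth_on_has_derivative[OF sm(2)])
qed

lemma vf_apply_bracket:
  assumes X: "X \<in> \<XX>" and Y: "Y \<in> \<XX>" and f: "f \<in> \<FF>" and p: "p \<in> carrier_of B"
  shows "vf_apply B (bracket B X Y) f p = vf_apply B X (vf_apply B Y f) p - vf_apply B Y (vf_apply B X f) p"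
proof -
  obtain c where c: "c \<in> B" "p \<in> dom_of c" using p by (rule carrierE)
  have *: "vf_apply B W (vf_apply B Z f) p = dderiv (loc W c) (dderiv (loc Z c) (f \<circ> chart_inv c)) (snd c p)"
    if "W \<in> \<XX>" "Z \<in> \<XX>" for W Z
    using that c f vf_apply_eq[OF that(2) f c(1)]
    by (auto simp: vf_apply_eq[of _ _ c] intro!: dderiv_cong_open[OF open_range])
  have "dderiv (loc (bracket B X Y) c) (f \<circ> chart_inv c) (snd c p) =
      frechet_derivative (f \<circ> chart_inv c) (at (snd c p))
        (dderiv (loc X c) (loc Y c) (snd c p) - dderiv (loc Y c) (loc X c) (snd c p))"
    unfolding dderiv_def[of "loc (bracket B X Y) c"] using c by (simp add: bracket_eq)
  then show ?thesis
    using dderiv_commutator[OF open_range[OF c(1)] smooth_functionD[OF f c(1)]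
        vector_fields_smooth[OF X c(1)] vector_fields_smooth[OF Y c(1)], of "snd c p"]
      *[OF X Y] *[OF Y X] c f X Y by (simp add: vf_apply_eq[of _ _ c])
qed

text \<open>On the components of \<open>Z\<close> the bracket of \<open>X\<close> and
  \<open>Y\<close> acts as the commutator of two derivations. Once this is used for all three inner
  brackets, what remains is a formal cancellation.\<close>

lemma jacobi:
  assumes X: "X \<in> \<XX>" and Y: "Y \<in> \<XX>" and Z: "Z \<in> \<XX>"
  shows "bracket B (bracket B X Y) Z = vf_diff B (bracket B X (bracket B Y Z)) (bracket B Y (bracket B X Z))"
proof (rule ext_field_eqI[of B])
  fix p c assume c: "c \<in> B" "p \<in> dom_of c"
  have *: "dderiv (loc (bracket B X Y) c) (loc Z c) (snd c p) =
      dderiv (loc X c) (dderiv (loc Y c) (loc Z c)) (snd c p) - dderiv (loc Y c) (dderiv (loc X c) (loc Z c)) (snd c p)"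
    if "X \<in> \<XX>" "Y \<in> \<XX>" "Z \<in> \<XX>" for X Y Z
  proof -
    have "dderiv (loc (bracket B X Y) c) (loc Z c) (snd c p) = frechet_derivative (loc Z c) (at (snd c p))
        (dderiv (loc X c) (loc Y c) (snd c p) - dderiv (loc Y c) (loc X c) (snd c p))"
      unfolding dderiv_def[of "loc (bracket B X Y) c"] using c by (simp add: bracket_eq)
    then show ?thesis
      using dderiv_commutator[OF open_range[OF c(1)] vector_fields_smooth[OF that(3) c(1)]
        vector_fields_smooth[OF that(1) c(1)] vector_fields_smooth[OF that(2) c(1)], of "snd c p"] c by simp
  qed
  show "bracket B (bracket B X Y) Z p c = vf_diff B (bracket B X (bracket B Y Z)) (bracket B Y (bracket B X Z)) p c"
    using c assms by (simp add: bracket_eq[OF c] * dderiv_loc_bracket)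
qed auto

lemma vf_add_diff_cancel: "X \<in> \<XX> \<Longrightarrow> Y \<in> \<XX> \<Longrightarrow> vf_add B (vf_diff B X Y) Y = X"
  by (rule ext_field_eqI[of B]) simp_all

lemma vf_diff_self: "vf_diff B X X = vf_zero B"
  by (rule ext_field_eqI[of B]) simp_all

lemma bracket_diff_left:
  assumes "X \<in> \<XX>" "Y \<in> \<XX>" "Z \<in> \<XX>"
  shows "bracket B (vf_diff B X Y) Z = vf_diff B (bracket B X Z) (bracket B Y Z)"
proof -
  have "bracket B X Z = vf_add B (bracket B (vf_diff B X Y) Z) (bracket B Y Z)"
    using bracket_add_left[of "vf_diff B X Y" Y Z] assms by (simp add: vf_add_diff_cancel)
  then show ?thesis by (intro ext_field_eqI[of B]) simp_all
qed

lemma bracket_zero_left: "Z \<in> \<XX> \<Longrightarrow> bracket B (vf_zero B) Z = vf_zero B"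
  using bracket_diff_left[of "vf_zero B" "vf_zero B" Z] by (simp add: vf_diff_self)

lemma vf_apply_const: "vf_apply B X (\<lambda>q. a) p = 0"
  by (simp add: vf_apply_def comp_def)

lemma vf_apply_fun_add:
  assumes "X \<in> \<XX>" "f \<in> \<FF>" "g \<in> \<FF>" "p \<in> carrier_of B"
  shows "vf_apply B X (\<lambda>q. f q + g q) p = vf_apply B X f p + vf_apply B X g p"
proof -
  have "vf_apply B X (\<lambda>q. f q + g q) p = vf_apply B X (\<lambda>q. f q - (0 - g q)) p" by simp
  also have "\<dots> = vf_apply B X f p - (vf_apply B X (\<lambda>q. 0) p - vf_apply B X g p)"
    using assms by (simp only: vf_apply_fun_diff const_in diff_in)
  finally show ?thesis by (simp add: vf_apply_const)
qed

section \<open>Algebra of linear connections\<close>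

lemma connection_in [simp]:
  "linear_connection B D \<Longrightarrow> X \<in> \<XX> \<Longrightarrow> Y \<in> \<XX> \<Longrightarrow> D X Y \<in> \<XX>"
  unfolding linear_connection_def by blast

lemma connection_add_left:
  "linear_connection B D \<Longrightarrow> X \<in> \<XX> \<Longrightarrow> X' \<in> \<XX> \<Longrightarrow> Y \<in> \<XX> \<Longrightarrow>
     D (vf_add B X X') Y = vf_add B (D X Y) (D X' Y)"
  unfolding linear_connection_def by blast

lemma connection_add_right:
  "linear_connection B D \<Longrightarrow> X \<in> \<XX> \<Longrightarrow> Y \<in> \<XX> \<Longrightarrow> Y' \<in> \<XX> \<Longrightarrow>
     D X (vf_add B Y Y') = vf_add B (D X Y) (D X Y')"
  unfolding linear_connection_def by blast

lemma connection_diff_right: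
  assumes D: "linear_connection B D" and X: "X \<in> \<XX>" and Y: "Y \<in> \<XX>" "Y' \<in> \<XX>"
  shows "D X (vf_diff B Y Y') = vf_diff B (D X Y) (D X Y')"
proof -
  have "D X Y = vf_add B (D X (vf_diff B Y Y')) (D X Y')"
    using connection_add_right[OF D X, of "vf_diff B Y Y'" Y'] Y by (simp add: vf_add_diff_cancel)
  then show ?thesis using D X Y by (intro ext_field_eqI[of B]) simp_all
qed

lemma connection_scale_const:
  assumes D: "linear_connection B D" and X: "X \<in> \<XX>" and Y: "Y \<in> \<XX>"
  shows "D X (vf_scale B (\<lambda>u. a) Y) = vf_scale B (\<lambda>u. a) (D X Y)"
proof -
  have "D X (vf_scale B (\<lambda>u. a) Y) =
      vf_add B (vf_scale B (vf_apply B X (\<lambda>u. a)) Y) (vf_scale B (\<lambda>u. a) (D X Y))"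
    using D X Y const_in unfolding linear_connection_def by blast
  also have "\<dots> = vf_scale B (\<lambda>u. a) (D X Y)"
    by (rule ext_field_eqI[of B]) (simp_all add: vf_apply_const)
  finally show ?thesis .
qed

end

section \<open>The slit tangent bundle\<close>

lemma smooth_atlas_of_manifold:
  assumes "smooth_manifold M A" shows "smooth_atlas A"
proof
  have A: "openin M (dom_of c)" "open (range_of c)"
    "homeomorphic_map (subtopology M (dom_of c)) (top_of_set (range_of c)) (snd c)" if "c \<in> A" for c
    using assms that by (auto simp: smooth_manifold_def)
  fix c assume c: "c \<in> A"
  have "dom_of c \<subseteq> topspace M" using A(1)[OF c] by (rule openin_subset)
  then have top: "topspace (subtopology M (dom_of c)) = dom_of c" by auto
  show "inj_on (snd c) (dom_of c)"
    using homeomorphic_imp_injective_map[OF A(3)[OF c]] top by simp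
  show "open (range_of c)" using A(2)[OF c] .
  fix d assume d: "d \<in> A"
  have "openin (subtopology M (dom_of c)) (dom_of c \<inter> dom_of d)"
    using A(1)[OF d] openin_subtopology_Int2 by blast
  \<comment> \<open>A homeomorphism is an open map, so the overlap has a relatively open image;
    openness of the range makes it open in the whole space.\<close>
  then have "openin (top_of_set (range_of c)) (snd c ` (dom_of c \<inter> dom_of d))"
    using homeomorphic_imp_open_map[OF A(3)[OF c]] by (simp add: open_map_def)
  then show "open (snd c ` (dom_of c \<inter> dom_of d))" using A(2)[OF c] openin_open_trans by blast
  show "smooth_on (snd c ` (dom_of c \<inter> dom_of d)) (transition c d)"
    using assms c d by (auto simp: smooth_manifold_def)
qed

definition slit_chart ::
    "('a, 'v::real_normed_vector) chart set \<Rightarrow> ('a, 'v) chart \<Rightarrow> (('a, 'v) tm, 'v \<times> 'v) chart" where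
  "slit_chart A c = ({u \<in> slit_bundle A. fst u \<in> dom_of c}, \<lambda>u. (snd c (fst u), snd u c))"

lemma slit_chart_simps [simp]:
  "dom_of (slit_chart A c) = {u \<in> slit_bundle A. fst u \<in> dom_of c}"
  "snd (slit_chart A c) u = (snd c (fst u), snd u c)"
  by (simp_all add: slit_chart_def)

lemma slit_atlas_eq: "slit_atlas A = slit_chart A ` A"
proof -
  have "(\<lambda>k. (dom_of k \<inter> slit_bundle A, snd k))
      ({u \<in> tangent_bundle A. fst u \<in> dom_of c}, \<lambda>u. (snd c (fst u), snd u c)) = slit_chart A c" for c
    by (auto simp: slit_chart_def slit_bundle_def)
  then show ?thesis unfolding slit_atlas_def tangent_atlas_def image_image by simp
qed

lemma carrier_slit_atlas: "carrier_of (slit_atlas A) = slit_bundle A"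
  by (auto simp: slit_atlas_eq carrier_of_def slit_bundle_def tangent_bundle_def)

section \<open>Induced charts and their transition maps\<close>

context smooth_atlas
begin

text \<open>The tangent vector with components \<open>y\<close> in chart \<open>c\<close>. It
  supplies the preimages which show that an induced chart fills its expected range.\<close>

definition tvec_of :: "('a, 'v) chart \<Rightarrow> 'a \<Rightarrow> 'v \<Rightarrow> ('a, 'v) tvec" where
  "tvec_of c p y = (\<lambda>d\<in>charts_at B p. frechet_derivative (transition c d) (at (snd c p)) y)"

lemma transition_self_deriv:
  assumes "c \<in> B" "p \<in> dom_of c"
  shows "frechet_derivative (transition c c) (at (snd c p)) y = y"
proof -
  have "frechet_derivative (transition c c) (at (snd c p)) = frechet_derivative (\<lambda>x. x) (at (snd c p))"
    by (rule frechet_derivative_cong_open[OF open_range[OF assms(1)]]) (use assms in \<open>auto simp: transition_def\<close>)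
  then show ?thesis by simp
qed

lemma transition_cocycle:
  assumes "c \<in> B" "d \<in> B" "e \<in> B" "p \<in> dom_of c" "p \<in> dom_of d" "p \<in> dom_of e"
  shows "frechet_derivative (transition c e) (at (snd c p)) y =
    frechet_derivative (transition d e) (at (snd d p)) (frechet_derivative (transition c d) (at (snd c p)) y)"
proof -
  have eq: "transition c e = (\<lambda>x. snd e (chart_inv c x))" for c by (auto simp: transition_def)
  have "transition d e differentiable at (snd d p)"
    using transition_deriv[of d e p] assms by (auto simp: differentiable_def)
  then show ?thesis
    unfolding eq using frechet_derivative_eqI[OF transition_comp_deriv[OF assms(1,2,4,5), of "snd e" "snd e"]]
    by (simp add: eq)
qed

lemma tvec_of_in:
  assumes "c \<in> B" "p \<in> dom_of c" shows "tvec_of c p y \<in> tangent_space B p"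
proof -
  have "tvec_of c p y e = frechet_derivative (transition d e) (at (snd d p)) (tvec_of c p y d)"
    if "d \<in> charts_at B p" "e \<in> charts_at B p" for d e
    unfolding tvec_of_def restrict_apply'[OF that(1)] restrict_apply'[OF that(2)]
    by (rule transition_cocycle) (use assms that in \<open>simp_all add: charts_at_def\<close>)
  moreover have "tvec_of c p y \<in> extensional (charts_at B p)" by (simp add: tvec_of_def)
  ultimately show ?thesis unfolding tangent_space_def by blast
qed

lemma tvec_of_apply: "c \<in> B \<Longrightarrow> p \<in> dom_of c \<Longrightarrow> tvec_of c p y c = y"
  by (simp add: tvec_of_def transition_self_deriv charts_at_def)

lemma tangent_space_transform:
  "w \<in> tangent_space B p \<Longrightarrow> c \<in> B \<Longrightarrow> d \<in> B \<Longrightarrow> p \<in> dom_of c \<Longrightarrow> p \<in> dom_of d \<Longrightarrow>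
     w d = frechet_derivative (transition c d) (at (snd c p)) (w c)"
  unfolding tangent_space_def charts_at_def by blast

lemma tangent_space_eqI:
  assumes "w \<in> tangent_space B p" "w' \<in> tangent_space B p" "c \<in> B" "p \<in> dom_of c" "w c = w' c"
  shows "w = w'"
proof (rule extensionalityI)
  show "w \<in> extensional (charts_at B p)" "w' \<in> extensional (charts_at B p)"
    using assms by (auto simp: tangent_space_def)
  show "w d = w' d" if "d \<in> charts_at B p" for d
  proof -
    have d: "d \<in> B" "p \<in> dom_of d" using that by (auto simp: charts_at_def)
    show ?thesis
      using tangent_space_transform[OF assms(1,3) d(1) assms(4) d(2)]
        tangent_space_transform[OF assms(2,3) d(1) assms(4) d(2)] assms(5) by simp
  qed
qed

text \<open>A tangent vector is determined by its components in one chart. Hence removing the zero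
  section removes exactly \<open>y = 0\<close> in each induced chart.\<close>

lemma zero_tvec_iff:
  assumes "w \<in> tangent_space B p" "c \<in> B" "p \<in> dom_of c"
  shows "w = zero_tvec B p \<longleftrightarrow> w c = 0"
proof -
  have 0: "zero_tvec B p \<in> tangent_space B p"
    unfolding tangent_space_def zero_tvec_def charts_at_def by (simp add: linear_0[OF linear_transition] del: split_paired_All)
  have "zero_tvec B p c = 0" using assms by (simp add: zero_tvec_def charts_at_def)
  then show ?thesis using tangent_space_eqI[OF assms(1) 0 assms(2,3)] by metis
qed

lemma slit_bundle_iff:
  assumes "c \<in> B" "p \<in> dom_of c"
  shows "(p, w) \<in> slit_bundle B \<longleftrightarrow> w \<in> tangent_space B p \<and> w c \<noteq> 0"
  using assms zero_tvec_iff[OF _ assms] by (auto simp: slit_bundle_def tangent_bundle_def in_carrier)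

lemma slit_overlap:
  assumes c: "c \<in> B"
  shows "snd (slit_chart B c) ` (dom_of (slit_chart B c) \<inter> dom_of (slit_chart B d)) =
    (snd c ` (dom_of c \<inter> dom_of d)) \<times> (- {0})" (is "?L = ?R")
proof
  show "?L \<subseteq> ?R" using slit_bundle_iff[OF c] by auto
  show "?R \<subseteq> ?L"
  proof
    fix z assume "z \<in> ?R"
    then obtain p y where p: "p \<in> dom_of c" "p \<in> dom_of d" "y \<noteq> 0" "z = (snd c p, y)" by auto
    then have "(p, tvec_of c p y) \<in> slit_bundle B" "tvec_of c p y c = y"
      using slit_bundle_iff[OF c p(1)] tvec_of_in[OF c p(1)] tvec_of_apply[OF c p(1)] by auto
    then show "z \<in> ?L" using p by (intro image_eqI[of _ _ "(p, tvec_of c p y)"]) auto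
  qed
qed

lemma slit_range: "c \<in> B \<Longrightarrow> range_of (slit_chart B c) = range_of c \<times> (- {0})"
  using slit_overlap[of c c] unfolding range_of_def Int_absorb .

lemma slit_inj:
  assumes c: "c \<in> B" shows "inj_on (snd (slit_chart B c)) (dom_of (slit_chart B c))"
proof (rule inj_onI)
  fix u u' assume u: "u \<in> dom_of (slit_chart B c)" "u' \<in> dom_of (slit_chart B c)"
    and eq: "snd (slit_chart B c) u = snd (slit_chart B c) u'"
  obtain p w where u1: "u = (p, w)" by (cases u)
  obtain p' w' where u2: "u' = (p', w')" by (cases u')
  note uu = u1 u2
  have mem: "(p, w) \<in> slit_bundle B" "p \<in> dom_of c" "(p', w') \<in> slit_bundle B" "p' \<in> dom_of c"
    using u by (simp_all add: uu)
  have eqs: "snd c p = snd c p'" "w c = w' c" using eq by (simp_all add: uu)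
  have p: "p' = p" by (rule inj_onD[OF inj[OF c] eqs(1)[symmetric] mem(4,2)])
  note w = slit_bundle_iff[OF c mem(2), THEN iffD1, OF mem(1), THEN conjunct1]
    slit_bundle_iff[OF c mem(4), THEN iffD1, OF mem(3), THEN conjunct1, unfolded p]
  have "w = w'"
    by (rule tangent_space_eqI[where w = w and w' = w' and p = p and c = c, OF w c mem(2) eqs(2)])
  then show "u = u'" by (simp add: uu p)
qed

text \<open>The map \<open>(x, y) \<mapsto> (t x, t'(x) y)\<close> for the base transition
  \<open>t\<close>. The basis expansion exhibits it through sums of products, which makes joint
  smoothness in \<open>(x, y)\<close> accessible.\<close>

definition lifted_transition :: "('a, 'v) chart \<Rightarrow> ('a, 'v) chart \<Rightarrow> 'v \<times> 'v \<Rightarrow> 'v \<times> 'v" where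
  "lifted_transition c d z = (transition c d (fst z), \<Sum>b\<in>Basis. (snd z \<bullet> b) *\<^sub>R
     frechet_derivative (transition c d) (at (fst z)) b)"

lemma slit_transition:
  assumes c: "c \<in> B" "d \<in> B"
    and z: "z \<in> snd (slit_chart B c) ` (dom_of (slit_chart B c) \<inter> dom_of (slit_chart B d))"
  shows "transition (slit_chart B c) (slit_chart B d) z = lifted_transition c d z"
proof -
  obtain u where u: "u \<in> slit_bundle B" "fst u \<in> dom_of c" "fst u \<in> dom_of d" "z = snd (slit_chart B c) u"
    using z by auto
  have "chart_inv (slit_chart B c) z = u"
    unfolding u(4) chart_inv_def by (rule inv_into_f_f[OF slit_inj[OF c(1)]]) (use u in simp)
  moreover have "snd u \<in> tangent_space B (fst u)" using u(1) by (auto simp: slit_bundle_def tangent_bundle_def)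
  ultimately have "transition (slit_chart B c) (slit_chart B d) z =
      (snd d (fst u), frechet_derivative (transition c d) (at (snd c (fst u))) (snd u c))"
    using tangent_space_transform[OF _ c u(2,3), of "snd u"] by (simp add: transition_def)
  moreover have "frechet_derivative (transition c d) (at (snd c (fst u))) (snd u c) =
      (\<Sum>b\<in>Basis. (snd u c \<bullet> b) *\<^sub>R frechet_derivative (transition c d) (at (snd c (fst u))) b)"
    using transition_deriv[OF c u(2,3)] by (intro frechet_derivative_euclidean) (auto simp: differentiable_def)
  ultimately show ?thesis using u c by (simp add: lifted_transition_def)
qed

lemma smooth_lifted_transition:
  assumes c: "c \<in> B" "d \<in> B"
  shows "smooth_on ((snd c ` (dom_of c \<inter> dom_of d)) \<times> (- {0})) (lifted_transition c d)"
proof -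
  let ?O = "snd c ` (dom_of c \<inter> dom_of d)"
  have op: "open (?O \<times> (- {0::'v}))" by (intro open_Times open_overlap c open_Compl) auto
  have comp: "smooth_on (?O \<times> (- {0::'v})) (\<lambda>z. f (fst z))" if "smooth_on ?O f" for f :: "'v \<Rightarrow> 'v"
    by (rule smooth_on_linear_comp[OF open_overlap[OF c] bounded_linear_fst op _ that]) auto
  have "smooth_on (?O \<times> (- {0::'v})) (\<lambda>z. snd z \<bullet> b)" for b :: 'v
    by (rule smooth_on_linear[OF op]) (intro bounded_linear_inner_left_comp bounded_linear_snd)
  then show ?thesis
    unfolding lifted_transition_def[abs_def]
    by (intro smooth_on_Pair[OF op] smooth_on_sum[OF op] smooth_on_scaleR[OF op] comp
        smooth_on_deriv smooth_transition[OF c])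
qed

lemma slit_smooth_atlas: "smooth_atlas (slit_atlas B)"
proof
  fix k assume "k \<in> slit_atlas B"
  then obtain c where c: "c \<in> B" and k: "k = slit_chart B c" by (auto simp: slit_atlas_eq)
  show "inj_on (snd k) (dom_of k)" using slit_inj[OF c] k by simp
  show "open (range_of k)" unfolding k slit_range[OF c]
    by (intro open_Times open_range c open_Compl) auto
  fix l assume "l \<in> slit_atlas B"
  then obtain d where d: "d \<in> B" and l: "l = slit_chart B d" by (auto simp: slit_atlas_eq)
  show op: "open (snd k ` (dom_of k \<inter> dom_of l))"
    unfolding k l slit_overlap[OF c] by (intro open_Times open_overlap c d open_Compl) auto
  have "smooth_on (snd k ` (dom_of k \<inter> dom_of l)) (lifted_transition c d)"
    unfolding k l slit_overlap[OF c] by (rule smooth_lifted_transition[OF c d])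
  then show "smooth_on (snd k ` (dom_of k \<inter> dom_of l)) (transition k l)"
    using smooth_on_cong[OF op, of "transition k l" "lifted_transition c d"] slit_transition[OF c d]
    unfolding k l by blast
qed

text \<open>The derivative of an induced transition is block triangular: the second derivative of
  the base transition enters only the fibre part of the image, and is fed by the base part of
  \<open>w\<close>. This is why \<open>J\<close> and \<open>C\<close> do not depend on the
  chart.\<close>

lemma slit_transition_deriv:
  assumes c: "c \<in> B" "d \<in> B" and u: "u \<in> slit_bundle B" "fst u \<in> dom_of c" "fst u \<in> dom_of d"
  defines "T \<equiv> transition (slit_chart B c) (slit_chart B d)"
    and "D \<equiv> frechet_derivative (transition c d) (at (snd c (fst u)))"
  shows "fst (frechet_derivative T (at (snd (slit_chart B c) u)) w) = D (fst w)"
    and "frechet_derivative T (at (snd (slit_chart B c) u)) (0, y) = (0, D y)"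
proof -
  let ?z = "snd (slit_chart B c) u"
  let ?t = "transition c d"
  let ?O = "snd (slit_chart B c) ` (dom_of (slit_chart B c) \<inter> dom_of (slit_chart B d))"
  have z: "?z \<in> ?O" by (rule imageI) (simp add: u)
  have op: "open ?O" unfolding slit_overlap[OF c(1)] by (intro open_Times open_overlap c open_Compl) auto
  have x: "fst ?z \<in> snd c ` (dom_of c \<inter> dom_of d)" using u(2,3) by (simp add: imageI)
  have 1: "((\<lambda>z. ?t (fst z)) has_derivative (\<lambda>w. D (fst w))) (at ?z)"
    using has_derivative_compose[OF bounded_linear_imp_has_derivative[OF bounded_linear_fst]
        smooth_on_has_derivative[OF smooth_transition[OF c] x]] by (simp add: D_def)
  have sm: "smooth_on (snd c ` (dom_of c \<inter> dom_of d)) (\<lambda>x. frechet_derivative ?t (at x) b)" for b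
    using smooth_on_deriv[OF smooth_transition[OF c]] .
  define D2 where "D2 b = frechet_derivative (\<lambda>x. frechet_derivative ?t (at x) b) (at (fst ?z))" for b
  have D2: "((\<lambda>x. frechet_derivative ?t (at x) b) has_derivative D2 b) (at (fst ?z))" for b
    using smooth_on_has_derivative[OF sm x] by (simp add: D2_def)
  have 2: "((\<lambda>z. frechet_derivative ?t (at (fst z)) b) has_derivative (\<lambda>w. D2 b (fst w))) (at ?z)" for b
    using has_derivative_compose[OF bounded_linear_imp_has_derivative[OF bounded_linear_fst] D2] .
  have 3: "((\<lambda>z. snd z \<bullet> b) has_derivative (\<lambda>w. snd w \<bullet> b)) (at ?z)" for b :: 'v
    by (intro bounded_linear_imp_has_derivative bounded_linear_inner_left_comp bounded_linear_snd)
  have "(lifted_transition c d has_derivative (\<lambda>w. (D (fst w), \<Sum>b\<in>Basis.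
      (snd ?z \<bullet> b) *\<^sub>R D2 b (fst w) + (snd w \<bullet> b) *\<^sub>R frechet_derivative ?t (at (fst ?z)) b))) (at ?z)"
    unfolding lifted_transition_def[abs_def]
    by (rule has_derivative_Pair[OF 1 has_derivative_sum[OF has_derivative_scaleR[OF 3 2]]])
  then have "(T has_derivative (\<lambda>w. (D (fst w), \<Sum>b\<in>Basis.
      (snd ?z \<bullet> b) *\<^sub>R D2 b (fst w) + (snd w \<bullet> b) *\<^sub>R frechet_derivative ?t (at (fst ?z)) b))) (at ?z)"
    using has_derivative_cong_open[OF op z, of T "lifted_transition c d"] slit_transition[OF c]
    unfolding T_def by blast
  from frechet_derivative_eqI[OF this]
  have *: "frechet_derivative T (at ?z) w = (D (fst w), \<Sum>b\<in>Basis.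
      (snd ?z \<bullet> b) *\<^sub>R D2 b (fst w) + (snd w \<bullet> b) *\<^sub>R frechet_derivative ?t (at (fst ?z)) b)" for w .
  show "fst (frechet_derivative T (at ?z) w) = D (fst w)" by (simp only: * fst_conv)
  have "D2 b 0 = 0" for b using has_derivative_linear[OF D2] linear_0 by blast
  moreover have "D 0 = 0" unfolding D_def using linear_0[OF linear_transition[OF c u(2,3)]] .
  moreover have "D y = (\<Sum>b\<in>Basis. (y \<bullet> b) *\<^sub>R frechet_derivative ?t (at (fst ?z)) b)"
    unfolding D_def using frechet_derivative_euclidean[of ?t "snd c (fst u)" y]
      transition_deriv[OF c u(2,3)] by (auto simp: differentiable_def)
  ultimately show "frechet_derivative T (at ?z) (0, y) = (0, D y)"
    by (simp only: * fst_conv snd_conv scaleR_zero_right add_0_left)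
qed

end

locale slit_bundle_atlas = base: smooth_atlas A for A :: "('a, 'v::euclidean_space) chart set"

sublocale slit_bundle_atlas \<subseteq> smooth_atlas "slit_atlas A"
  by (rule base.slit_smooth_atlas)

section \<open>The almost tangent structure and the Liouville field\<close>

context slit_bundle_atlas
begin

abbreviation "B \<equiv> slit_atlas A"
abbreviation "J \<equiv> almost_tangent A"
abbreviation "C \<equiv> liouville A"
abbreviation lie ("\<lbrakk>_, _\<rbrakk>") where "lie X Y \<equiv> bracket B X Y"

lemma J_apply [simp]: "k \<in> B \<Longrightarrow> u \<in> dom_of k \<Longrightarrow> J X u k = (0, fst (X u k))"
  by (simp add: almost_tangent_def)

lemma C_apply [simp]: "k \<in> B \<Longrightarrow> u \<in> dom_of k \<Longrightarrow> C u k = (0, snd (snd k u))"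
  by (simp add: liouville_def)

lemma ext_field_J [simp]: "ext_field B (J X)"
  unfolding almost_tangent_def by (rule ext_field_mk_field)

lemma J_in [simp]: assumes "X \<in> \<XX>" shows "J X \<in> \<XX>"
  unfolding almost_tangent_def
proof (rule mk_field_in)
  fix u k l assume kl: "k \<in> B" "l \<in> B" and u: "u \<in> dom_of k" "u \<in> dom_of l"
  obtain c d where c: "c \<in> A" "k = slit_chart A c" and d: "d \<in> A" "l = slit_chart A d"
    using kl by (auto simp: slit_atlas_eq)
  have "u \<in> slit_bundle A" "fst u \<in> dom_of c" "fst u \<in> dom_of d" using u c d by auto
  from base.slit_transition_deriv[OF c(1) d(1) this]
  show "(0, fst (X u l)) = frechet_derivative (transition k l) (at (snd k u)) (0, fst (X u k))"
    using vector_fields_transform[OF assms kl u] c d by simp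
next
  fix k assume k: "k \<in> B"
  show "smooth_on (range_of k) (\<lambda>x. (0, fst (X (chart_inv k x) k)))"
    by (rule smooth_on_bounded_linear[OF open_range[OF k] _ vector_fields_smooth[OF assms k],
          where L = "\<lambda>z. (0, fst z)"])
      (intro bounded_linear_Pair bounded_linear_zero bounded_linear_fst)
qed

lemma C_in [simp]: "C \<in> \<XX>"
  unfolding liouville_def
proof (rule mk_field_in)
  fix u k l assume kl: "k \<in> B" "l \<in> B" and u: "u \<in> dom_of k" "u \<in> dom_of l"
  obtain c d where c: "c \<in> A" "k = slit_chart A c" and d: "d \<in> A" "l = slit_chart A d"
    using kl by (auto simp: slit_atlas_eq)
  have uu: "u \<in> slit_bundle A" "fst u \<in> dom_of c" "fst u \<in> dom_of d" using u c d by auto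
  have "snd u \<in> tangent_space A (fst u)" using uu by (auto simp: slit_bundle_def tangent_bundle_def)
  from base.tangent_space_transform[OF this c(1) d(1) uu(2,3)]
    base.slit_transition_deriv(2)[OF c(1) d(1) uu, of "snd u c"]
  show "(0, snd (snd l u)) = frechet_derivative (transition k l) (at (snd k u)) (0, snd (snd k u))"
    unfolding c(2) d(2) by simp
next
  fix k assume k: "k \<in> B"
  have "smooth_on (range_of k) (\<lambda>x. (0, snd x))"
    by (intro smooth_on_linear open_range k bounded_linear_Pair bounded_linear_zero bounded_linear_snd)
  then show "smooth_on (range_of k) (\<lambda>x. (0, snd (snd k (chart_inv k x))))"
    by (subst smooth_on_cong[OF open_range[OF k]]) auto
qed

lemma J_add: "J (vf_add B X Y) = vf_add B (J X) (J Y)"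
  and J_diff: "J (vf_diff B X Y) = vf_diff B (J X) (J Y)"
  and J_scale: "J (vf_scale B f X) = vf_scale B f (J X)"
  and J_J: "J (J X) = vf_zero B"
proof -
  show "J (vf_add B X Y) = vf_add B (J X) (J Y)" by (rule ext_field_eqI[of B]) simp_all
  show "J (vf_diff B X Y) = vf_diff B (J X) (J Y)" by (rule ext_field_eqI[of B]) simp_all
  show "J (vf_scale B f X) = vf_scale B f (J X)" by (rule ext_field_eqI[of B]) simp_all
  show "J (J X) = vf_zero B" by (rule ext_field_eqI[of B]) (simp_all add: zero_prod_def)
qed

lemma dderiv_loc_J:
  assumes X: "X \<in> \<XX>" and k: "k \<in> B" "u \<in> dom_of k"
  shows "dderiv Z (loc (J X) k) (snd k u) = (0, fst (dderiv Z (loc X k) (snd k u)))"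
proof -
  have "frechet_derivative (loc (J X) k) (at (snd k u)) = frechet_derivative (\<lambda>x. (0, fst (loc X k x))) (at (snd k u))"
    using loc_cong[OF k, of "\<lambda>q. J X q k" "\<lambda>q. (0, fst (X q k))"] k by simp
  then show ?thesis
    unfolding dderiv_def
  proof (simp only:, intro frechet_derivative_eqI)
    show "((\<lambda>x. (0, fst (loc X k x))) has_derivative (\<lambda>w. (0, fst (frechet_derivative (loc X k) (at (snd k u)) w))))
      (at (snd k u))"
      using k by (intro has_derivative_Pair has_derivative_const has_derivative_fst
        smooth_on_has_derivative[OF vector_fields_smooth[OF X k(1)]]) auto
  qed
qed

lemma dderiv_loc_C:
  assumes k: "k \<in> B" "u \<in> dom_of k"
  shows "dderiv Z (loc C k) (snd k u) = (0, snd (Z (snd k u)))"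
proof -
  have "frechet_derivative (loc C k) (at (snd k u)) = frechet_derivative (\<lambda>x. (0, snd x)) (at (snd k u))"
    by (rule frechet_derivative_cong_open[OF open_range[OF k(1)]]) (use k in auto)
  then show ?thesis
    unfolding dderiv_def
  proof (simp only:, intro frechet_derivative_eqI)
    show "((\<lambda>x. (0, snd x)) has_derivative (\<lambda>w. (0, snd w))) (at (snd k u))"
      by (intro bounded_linear_imp_has_derivative bounded_linear_Pair bounded_linear_zero bounded_linear_snd)
  qed
qed

text \<open>In induced coordinates \<open>J\<close> has constant coefficients, so derivatives pass
  through it. This is the vanishing of the Nijenhuis tensor, whose fourth term contains
  \<open>J \<circ> J = 0\<close>.\<close>

lemma nijenhuis_J:
  assumes "X \<in> \<XX>" "Y \<in> \<XX>"
  shows "\<lbrakk>J X, J Y\<rbrakk> = vf_add B (J \<lbrakk>J X, Y\<rbrakk>) (J \<lbrakk>X, J Y\<rbrakk>)"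
  using assms by (intro ext_field_eqI[of B]) (simp_all add: bracket_eq dderiv_loc_J prod_eq_iff)

text \<open>The Lie derivative of \<open>J\<close> along \<open>C\<close> is \<open>- J\<close>,
  because the flow of \<open>C\<close> scales the fibre coordinates and fixes the base
  coordinates.\<close>

lemma bracket_C_J:
  assumes "X \<in> \<XX>" shows "\<lbrakk>C, J X\<rbrakk> = vf_diff B (J \<lbrakk>C, X\<rbrakk>) (J X)"
  using assms by (intro ext_field_eqI[of B]) (simp_all add: bracket_eq dderiv_loc_J dderiv_loc_C prod_eq_iff)

text \<open>By \<open>J S = C\<close> the base part of \<open>S\<close> is the fibre coordinate
  itself, and its derivative along a vertical \<open>V\<close> returns the fibre part of
  \<open>V\<close>. The other term of the bracket differentiates the base part of \<open>V\<close>,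
  which is zero.\<close>

lemma vertical_eq:
  assumes V: "V \<in> \<XX>" "J V = vf_zero B" and S: "S \<in> \<XX>" "J S = C"
  shows "J \<lbrakk>V, S\<rbrakk> = V"
proof (rule ext_field_eqI[of B])
  fix u k assume k: "k \<in> B" "u \<in> dom_of k"
  have "fst (V u k) = 0"
    using J_apply[OF k, of V] vf_zero_apply[OF k] unfolding V(2) by (simp add: zero_prod_def)
  then have 1: "V u k = (0, snd (V u k))" by (simp add: prod_eq_iff)
  have "frechet_derivative (loc (vf_zero B) k) (at (snd k u)) = frechet_derivative (\<lambda>x. 0) (at (snd k u))"
    using loc_cong[OF k, of "\<lambda>q. vf_zero B q k" "\<lambda>q. 0"] k by simp
  then have 2: "fst (dderiv (loc S k) (loc V k) (snd k u)) = 0"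
    using dderiv_loc_J[OF V(1) k, of "loc S k"] unfolding V(2) dderiv_def by (simp add: zero_prod_def)
  have 3: "fst (dderiv (loc V k) (loc S k) (snd k u)) = snd (V u k)"
    using dderiv_loc_J[OF S(1) k, of "loc V k"] dderiv_loc_C[OF k, of "loc V k"] k
    unfolding S(2) by simp
  have "J \<lbrakk>V, S\<rbrakk> u k = (0, snd (V u k))"
    unfolding J_apply[OF k] bracket_eq[OF k] by (simp add: 2 3)
  then show "J \<lbrakk>V, S\<rbrakk> u k = V u k" using 1 by simp
qed (use assms in auto)

end

section \<open>The Barthel projectors and the almost complex structure\<close>

locale semispray = slit_bundle_atlas A for A :: "('a, 'v::euclidean_space) chart set" +
  fixes S :: "('a, 'v) tm_field"
  assumes S_in [simp]: "S \<in> \<XX>" and J_S: "J S = C"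
begin

abbreviation "\<Gamma> \<equiv> barthel A S"
abbreviation "h \<equiv> h_proj A S"
abbreviation "v \<equiv> v_proj A S"
abbreviation "F \<equiv> almost_complex A S"

lemma barthel_in [simp]: "X \<in> \<XX> \<Longrightarrow> \<Gamma> X \<in> \<XX>"
  by (simp add: barthel_def)

lemma h_in [simp]: "X \<in> \<XX> \<Longrightarrow> h X \<in> \<XX>"
  by (simp add: h_proj_def)

lemma v_in [simp]: "X \<in> \<XX> \<Longrightarrow> v X \<in> \<XX>"
  by (simp add: v_proj_def)

lemma h_apply: "k \<in> B \<Longrightarrow> u \<in> dom_of k \<Longrightarrow> h X u k = (1/2) *\<^sub>R (X u k + \<Gamma> X u k)"
  by (simp add: h_proj_def)

lemma v_apply: "k \<in> B \<Longrightarrow> u \<in> dom_of k \<Longrightarrow> v X u k = (1/2) *\<^sub>R (X u k - \<Gamma> X u k)"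
  by (simp add: v_proj_def)

lemma ext_field_h_v [simp]: "ext_field B (h X)" "ext_field B (v X)" "ext_field B (\<Gamma> X)"
  by (simp_all add: h_proj_def v_proj_def barthel_def)

lemma J_zero: "J (vf_zero B) = vf_zero B"
  by (rule ext_field_eqI[of B]) (simp_all add: zero_prod_def)

lemma barthel_add:
  assumes "X \<in> \<XX>" "Y \<in> \<XX>" shows "\<Gamma> (vf_add B X Y) = vf_add B (\<Gamma> X) (\<Gamma> Y)"
  unfolding barthel_def J_add bracket_add_left[OF assms S_in]
    bracket_add_left[OF J_in[OF assms(1)] J_in[OF assms(2)] S_in]
  by (rule ext_field_eqI[of B]) simp_all

text \<open>Both brackets produce the same derivative term \<open>(S f) J X\<close>, and the
  difference in \<open>\<Gamma>\<close> cancels it.\<close>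

lemma barthel_scale:
  assumes "f \<in> \<FF>" "X \<in> \<XX>" shows "\<Gamma> (vf_scale B f X) = vf_scale B f (\<Gamma> X)"
  unfolding barthel_def J_scale bracket_scale_left[OF assms(2,1) S_in]
    bracket_scale_left[OF J_in[OF assms(2)] assms(1) S_in]
  by (rule ext_field_eqI[of B]) (simp_all add: scaleR_diff_right)

lemma h_add: "X \<in> \<XX> \<Longrightarrow> Y \<in> \<XX> \<Longrightarrow> h (vf_add B X Y) = vf_add B (h X) (h Y)"
  by (rule ext_field_eqI[of B]) (simp_all add: h_apply barthel_add algebra_simps)

lemma v_add: "X \<in> \<XX> \<Longrightarrow> Y \<in> \<XX> \<Longrightarrow> v (vf_add B X Y) = vf_add B (v X) (v Y)"
  by (rule ext_field_eqI[of B]) (simp_all add: v_apply barthel_add algebra_simps)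

lemma h_scale: "f \<in> \<FF> \<Longrightarrow> X \<in> \<XX> \<Longrightarrow> h (vf_scale B f X) = vf_scale B f (h X)"
  by (rule ext_field_eqI[of B]) (simp_all add: h_apply barthel_scale algebra_simps)

lemma v_scale: "f \<in> \<FF> \<Longrightarrow> X \<in> \<XX> \<Longrightarrow> v (vf_scale B f X) = vf_scale B f (v X)"
  by (rule ext_field_eqI[of B]) (simp_all add: v_apply barthel_scale algebra_simps)

lemma h_diff:
  assumes "X \<in> \<XX>" "Y \<in> \<XX>" shows "h (vf_diff B X Y) = vf_diff B (h X) (h Y)"
proof -
  have "h X = vf_add B (h (vf_diff B X Y)) (h Y)"
    using h_add[of "vf_diff B X Y" Y] assms by (simp add: vf_add_diff_cancel)
  then show ?thesis by (intro ext_field_eqI[of B]) simp_all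
qed

lemma v_diff:
  assumes "X \<in> \<XX>" "Y \<in> \<XX>" shows "v (vf_diff B X Y) = vf_diff B (v X) (v Y)"
proof -
  have "v X = vf_add B (v (vf_diff B X Y)) (v Y)"
    using v_add[of "vf_diff B X Y" Y] assms by (simp add: vf_add_diff_cancel)
  then show ?thesis by (intro ext_field_eqI[of B]) simp_all
qed

lemma h_plus_v: "X \<in> \<XX> \<Longrightarrow> vf_add B (h X) (v X) = X"
  by (rule ext_field_eqI[of B]) (simp_all add: h_apply v_apply algebra_simps flip: scaleR_add_left)

lemma v_eq: "X \<in> \<XX> \<Longrightarrow> v X = vf_diff B X (h X)"
  by (rule ext_field_eqI[of B]) (simp_all add: h_apply v_apply algebra_simps flip: scaleR_add_left)

lemma J_bracket_J_S: "X \<in> \<XX> \<Longrightarrow> J \<lbrakk>J X, S\<rbrakk> = J X"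
  by (rule vertical_eq) (simp_all add: J_J J_S)

text \<open>The second term of \<open>\<Gamma> X\<close> dies under \<open>J\<close> and the first
  returns \<open>J X\<close>. So \<open>\<Gamma> X\<close> and \<open>X\<close> differ by a vertical
  field; together with \<open>\<Gamma> = - I\<close> on vertical fields this makes \<open>h\<close>
  and \<open>v\<close> complementary projectors.\<close>

lemma J_barthel: "X \<in> \<XX> \<Longrightarrow> J (\<Gamma> X) = J X"
  unfolding barthel_def J_diff J_bracket_J_S J_J
  by (rule ext_field_eqI[of B]) simp_all

lemma J_h: "X \<in> \<XX> \<Longrightarrow> J (h X) = J X"
  unfolding h_proj_def J_scale J_add J_barthel
  by (rule ext_field_eqI[of B]) simp_all

lemma J_v: "X \<in> \<XX> \<Longrightarrow> J (v X) = vf_zero B"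
  unfolding v_proj_def J_scale J_diff J_barthel
  by (rule ext_field_eqI[of B]) simp_all

lemma barthel_vertical:
  assumes "V \<in> \<XX>" "J V = vf_zero B" shows "\<Gamma> V = vf_diff B (vf_zero B) V"
  unfolding barthel_def assms(2) vertical_eq[OF assms S_in J_S] bracket_zero_left[OF S_in] ..

lemma h_vertical: "V \<in> \<XX> \<Longrightarrow> J V = vf_zero B \<Longrightarrow> h V = vf_zero B"
  by (rule ext_field_eqI[of B]) (simp_all add: h_apply barthel_vertical)

lemma v_vertical: "V \<in> \<XX> \<Longrightarrow> J V = vf_zero B \<Longrightarrow> v V = V"
  by (rule ext_field_eqI[of B]) (simp_all add: v_apply barthel_vertical flip: scaleR_2)

lemma v_J: "X \<in> \<XX> \<Longrightarrow> v (J X) = J X"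
  by (simp add: v_vertical J_J)

text \<open>The difference of the two fields is vertical, and \<open>h\<close> annihilates it. So a
  bracket under \<open>h\<close> may be replaced by any field with the same image under
  \<open>J\<close>.\<close>

lemma h_eqI:
  assumes "X \<in> \<XX>" "Y \<in> \<XX>" "J X = J Y" shows "h X = h Y"
proof -
  have "J (vf_diff B X Y) = vf_zero B"
    unfolding J_diff assms(3) by (rule vf_diff_self)
  then have eq: "vf_diff B (h X) (h Y) = vf_zero B"
    using h_vertical[of "vf_diff B X Y"] h_diff assms by simp
  have "h X u k = h Y u k" if "k \<in> B" "u \<in> dom_of k" for u k
    using arg_cong[OF eq, of "\<lambda>Z. Z u k"] that by simp
  then show ?thesis by (intro ext_field_eqI[of B]) simp_all
qed

lemma h_h: "X \<in> \<XX> \<Longrightarrow> h (h X) = h X"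
  by (rule h_eqI) (simp_all add: J_h)

lemma v_h: "X \<in> \<XX> \<Longrightarrow> v (h X) = vf_zero B"
  by (rule ext_field_eqI[of B]) (simp_all add: v_eq h_h)

text \<open>Makes the vertical part an explicit \<open>J\<close>-image, so that relations stated for
  \<open>J\<close>-images apply to \<open>v X\<close>.\<close>

lemma v_lift: "X \<in> \<XX> \<Longrightarrow> v X = J \<lbrakk>v X, S\<rbrakk>"
  by (rule vertical_eq[symmetric]) (simp_all add: J_v J_S)

text \<open>Since \<open>J [V, S] = V\<close> for vertical \<open>V\<close>, the field \<open>h [V, S]\<close> is the horizontal lift of \<open>V\<close>; this
  gives \<open>F\<close> globally, without coordinates.\<close>

definition F_explicit :: "('a, 'v) tm_field \<Rightarrow> ('a, 'v) tm_field" where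
  "F_explicit X = vf_diff B (h \<lbrakk>v X, S\<rbrakk>) (J X)"

lemma F_explicit_J: "X \<in> \<XX> \<Longrightarrow> F_explicit (J X) = h X"
proof -
  assume X: "X \<in> \<XX>"
  have "h \<lbrakk>J X, S\<rbrakk> = h X" by (rule h_eqI) (simp_all add: X J_bracket_J_S)
  then show ?thesis unfolding F_explicit_def v_J[OF X] J_J
    by (intro ext_field_eqI[of B]) simp_all
qed

lemma F_explicit_h: "X \<in> \<XX> \<Longrightarrow> F_explicit (h X) = vf_scale B (\<lambda>u. - 1) (J X)"
proof -
  assume X: "X \<in> \<XX>"
  have "h (vf_zero B) = vf_zero B" by (rule h_vertical) (simp_all add: J_zero)
  then show ?thesis unfolding F_explicit_def v_h[OF X] bracket_zero_left[OF S_in] J_h[OF X]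
    by (intro ext_field_eqI[of B]) simp_all
qed

lemma F_explicit_add:
  assumes X: "X \<in> \<XX>" and Y: "Y \<in> \<XX>"
  shows "F_explicit (vf_add B X Y) = vf_add B (F_explicit X) (F_explicit Y)"
proof -
  have "h \<lbrakk>v (vf_add B X Y), S\<rbrakk> = vf_add B (h \<lbrakk>v X, S\<rbrakk>) (h \<lbrakk>v Y, S\<rbrakk>)"
    using X Y by (simp add: v_add bracket_add_left h_add)
  then show ?thesis unfolding F_explicit_def J_add by (intro ext_field_eqI[of B]) simp_all
qed

lemma F_explicit_scale:
  assumes f: "f \<in> \<FF>" and X: "X \<in> \<XX>"
  shows "F_explicit (vf_scale B f X) = vf_scale B f (F_explicit X)"
proof -
  \<comment> \<open>The derivative term of the bracket is vertical and \<open>h\<close> removes it;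
    this makes the formula function-linear although the bracket is not.\<close>
  have "h (vf_scale B (vf_apply B S f) (v X)) = vf_zero B"
    using f X by (intro h_vertical) (simp_all add: J_scale J_v, intro ext_field_eqI[of B], simp_all)
  then have "h \<lbrakk>v (vf_scale B f X), S\<rbrakk> = vf_diff B (vf_scale B f (h \<lbrakk>v X, S\<rbrakk>)) (vf_zero B)"
    using f X by (simp add: v_scale bracket_scale_left h_diff h_scale)
  then show ?thesis unfolding F_explicit_def J_scale
    by (intro ext_field_eqI[of B]) (simp_all add: scaleR_diff_right)
qed

lemma almost_complex_eq: "F = restrict F_explicit \<XX>"
  unfolding almost_complex_def tm_fields_def
proof (rule the_equality, intro conjI ballI)
  show "restrict F_explicit \<XX> \<in> \<XX> \<rightarrow>\<^sub>E \<XX>" by (auto simp: F_explicit_def)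
next
  fix G assume G: "G \<in> \<XX> \<rightarrow>\<^sub>E \<XX> \<and>
     (\<forall>\<zeta>\<in>\<XX>. \<forall>\<eta>\<in>\<XX>. G (vf_add B \<zeta> \<eta>) = vf_add B (G \<zeta>) (G \<eta>)) \<and>
     (\<forall>f\<in>\<FF>. \<forall>\<zeta>\<in>\<XX>. G (vf_scale B f \<zeta>) = vf_scale B f (G \<zeta>)) \<and>
     (\<forall>\<zeta>\<in>\<XX>. G (J \<zeta>) = h \<zeta>) \<and>
     (\<forall>\<zeta>\<in>\<XX>. G (h \<zeta>) = vf_scale B (\<lambda>u. - 1) (J \<zeta>))"
  show "G = restrict F_explicit \<XX>"
  proof (rule extensionalityI[of _ \<XX>])
    show "G \<in> extensional \<XX>" using G by (auto simp: PiE_def)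
    fix X assume X: "X \<in> \<XX>"
    \<comment> \<open>The conditions on \<open>G\<close> force its values on both summands of
      \<open>X\<close>: \<open>v X\<close> is a \<open>J\<close>-image, and on \<open>h X\<close>
      the value is prescribed.\<close>
    have "G (v X) = h \<lbrakk>v X, S\<rbrakk>" using G v_lift[OF X] X by (metis S_in bracket_in v_in)
    moreover have "G X = vf_add B (G (h X)) (G (v X))" using G X h_plus_v[OF X] by (metis h_in v_in)
    moreover have "G (h X) = vf_scale B (\<lambda>u. - 1) (J X)" using G X by blast
    ultimately have "G X = vf_add B (vf_scale B (\<lambda>u. - 1) (J X)) (h \<lbrakk>v X, S\<rbrakk>)" by simp
    also have "\<dots> = F_explicit X"
      unfolding F_explicit_def by (rule ext_field_eqI[of B]) simp_all
    finally show "G X = restrict F_explicit \<XX> X" using X by simp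
  qed simp
qed (simp_all add: F_explicit_add F_explicit_scale F_explicit_J F_explicit_h)

lemma F_eq: "X \<in> \<XX> \<Longrightarrow> F X = vf_diff B (h \<lbrakk>v X, S\<rbrakk>) (J X)"
  by (simp add: almost_complex_eq F_explicit_def)

lemma F_J: "X \<in> \<XX> \<Longrightarrow> F (J X) = h X"
  by (simp add: almost_complex_eq F_explicit_J)

section \<open>Connections for which the splitting is parallel\<close>

lemma parallel_h:
  assumes D: "linear_connection B D" and par: "parallel11 B D \<Gamma>" and X: "X \<in> \<XX>" and Y: "Y \<in> \<XX>"
  shows "D X (h Y) = h (D X Y)"
  using assms unfolding h_proj_def parallel11_def
  by (simp add: connection_scale_const connection_add_right)

lemma parallel_v:
  assumes D: "linear_connection B D" and par: "parallel11 B D \<Gamma>" and X: "X \<in> \<XX>" and Y: "Y \<in> \<XX>"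
  shows "D X (v Y) = v (D X Y)"
  using assms unfolding v_proj_def parallel11_def
  by (simp add: connection_scale_const connection_diff_right)

text \<open>\<open>\<lbrakk>v (D X Y), S\<rbrakk>\<close> and
  \<open>D X \<lbrakk>v Y, S\<rbrakk>\<close> have the same image \<open>v (D X Y)\<close> under
  \<open>J\<close>, hence the same horizontal part. The covariant derivative of the bracket itself
  never has to be computed.\<close>

lemma parallel_almost_complex:
  assumes D: "linear_connection B D" and J: "parallel11 B D J" and \<Gamma>: "parallel11 B D \<Gamma>"
  shows "parallel11 B D F"
  unfolding parallel11_def
proof (intro ballI)
  fix X Y assume X: "X \<in> \<XX>" and Y: "Y \<in> \<XX>"
  have J': "D X (J Z) = J (D X Z)" if "Z \<in> \<XX>" for Z using J X that by (simp add: parallel11_def)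
  let ?Z = "\<lbrakk>v Y, S\<rbrakk>"
  have Z: "?Z \<in> \<XX>" using Y by simp
  have "v (D X Y) = J (D X ?Z)"
    using parallel_v[OF D \<Gamma> X Y] J'[OF Z] v_lift[OF Y] by simp
  then have "h \<lbrakk>v (D X Y), S\<rbrakk> = h (D X ?Z)"
    using D X Z by (intro h_eqI) (simp_all add: J_bracket_J_S)
  also have "\<dots> = D X (h ?Z)" using parallel_h[OF D \<Gamma> X Z] ..
  finally show "D X (F Y) = F (D X Y)"
    using D X Y J'[OF Y] by (simp add: F_eq connection_diff_right)
qed

lemma connection_eqI:
  assumes D: "linear_connection B D" "parallel11 B D F" and D': "linear_connection B D'" "parallel11 B D' F"
    and JJ: "\<And>X Y. X \<in> \<XX> \<Longrightarrow> Y \<in> \<XX> \<Longrightarrow> D (J X) (J Y) = D' (J X) (J Y)"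
    and hJ: "\<And>X Y. X \<in> \<XX> \<Longrightarrow> Y \<in> \<XX> \<Longrightarrow> D (h X) (J Y) = D' (h X) (J Y)"
    and X: "X \<in> \<XX>" and Y: "Y \<in> \<XX>"
  shows "D X Y = D' X Y"
proof -
  have J: "D X (J Z) = D' X (J Z)" if Z: "Z \<in> \<XX>" for Z
  proof -
    have split: "K X (J Z) = vf_add B (K (h X) (J Z)) (K (v X) (J Z))" if "linear_connection B K" for K
      using connection_add_left[OF that, of "h X" "v X" "J Z"] X Z by (simp add: h_plus_v)
    have "D (v X) (J Z) = D' (v X) (J Z)"
      using JJ[of "\<lbrakk>v X, S\<rbrakk>" Z] X Z by (simp flip: v_lift)
    then show ?thesis using split[OF D(1)] split[OF D'(1)] hJ[OF X Z] by simp
  qed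
  have "D X (v Y) = D' X (v Y)" using J[of "\<lbrakk>v Y, S\<rbrakk>"] Y by (simp flip: v_lift)
  moreover have "K X (h Y) = F (K X (J Y))" if "parallel11 B K F" for K
    using that X Y F_J[OF Y] J_in[OF Y] by (metis parallel11_def)
  then have "D X (h Y) = D' X (h Y)" using J[OF Y] D(2) D'(2) by simp
  moreover have "K X Y = vf_add B (K X (h Y)) (K X (v Y))" if "linear_connection B K" for K
    using connection_add_right[OF that X, of "h Y" "v Y"] Y by (simp add: h_plus_v)
  ultimately show ?thesis using D(1) D'(1) by metis
qed

end

section \<open>The fundamental form and the Cartan tensor\<close>

locale finsler = slit_bundle_atlas A for A :: "('a, 'v::euclidean_space) chart set" +
  fixes E :: "('a, 'v) tm \<Rightarrow> real"
  assumes E_in [simp]: "E \<in> \<FF>"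
    and euler: "\<And>u. u \<in> carrier_of B \<Longrightarrow> vf_apply B C E u = 2 * E u"
    and nondegenerate: "maximal_rank A (Omega A E)"
begin

abbreviation "act \<equiv> vf_apply B"
abbreviation "\<Omega> \<equiv> Omega A E"

lemma d_J_in [simp]: "X \<in> \<XX> \<Longrightarrow> d_J A E X \<in> \<FF>"
  by (simp add: d_J_def)

lemma act_fun_diff_cong:
  assumes "\<And>q. q \<in> carrier_of B \<Longrightarrow> f q = g q - g' q" "X \<in> \<XX>" "g \<in> \<FF>" "g' \<in> \<FF>" "u \<in> carrier_of B"
  shows "act X f u = act X g u - act X g' u"
  using vf_apply_cong[of f "\<lambda>q. g q - g' q" u X X] vf_apply_fun_diff[of X g g' u] assms by simp

lemma Omega_diff_left:
  assumes X: "X \<in> \<XX>" and Y: "Y \<in> \<XX>" and Z: "Z \<in> \<XX>" and u: "u \<in> carrier_of B"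
  shows "\<Omega> (vf_diff B X Y) Z u = \<Omega> X Z u - \<Omega> Y Z u"
proof -
  have d: "d_J A E (vf_diff B X Y) q = d_J A E X q - d_J A E Y q"
    if "q \<in> carrier_of B" "X \<in> \<XX>" "Y \<in> \<XX>" for q X Y
    using that by (simp add: d_J_def J_diff vf_apply_diff)
  have "act Z (d_J A E (vf_diff B X Y)) u = act Z (d_J A E X) u - act Z (d_J A E Y) u"
    by (rule act_fun_diff_cong) (use d X Y Z u in simp_all)
  moreover have "d_J A E \<lbrakk>vf_diff B X Y, Z\<rbrakk> u = d_J A E \<lbrakk>X, Z\<rbrakk> u - d_J A E \<lbrakk>Y, Z\<rbrakk> u"
    using d[OF u, of "\<lbrakk>X, Z\<rbrakk>" "\<lbrakk>Y, Z\<rbrakk>"] X Y Z by (simp add: bracket_diff_left)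
  ultimately show ?thesis
    using X Y Z u by (simp add: Omega_def vf_apply_diff)
qed

lemma Omega_zero_left: "Z \<in> \<XX> \<Longrightarrow> u \<in> carrier_of B \<Longrightarrow> \<Omega> (vf_zero B) Z u = 0"
  using Omega_diff_left[of "vf_zero B" "vf_zero B" Z u] by (simp add: vf_diff_self)

text \<open>Maximal rank is a condition at each point with global test fields, so it yields equality
  point by point. Both \<open>J S = C\<close> and the uniqueness of the Cartan tensor are obtained
  through it.\<close>

lemma Omega_eqI:
  assumes X: "X \<in> \<XX>" and Y: "Y \<in> \<XX>"
    and eq: "\<And>Z u. Z \<in> \<XX> \<Longrightarrow> u \<in> carrier_of B \<Longrightarrow> \<Omega> X Z u = \<Omega> Y Z u"
  shows "X = Y"
proof (rule ext_field_eqI[of B])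
  fix u k assume k: "k \<in> B" "u \<in> dom_of k"
  then have u: "u \<in> carrier_of B" by (rule in_carrier)
  have "\<Omega> (vf_diff B X Y) Z u = 0" if "Z \<in> \<XX>" for Z
    using Omega_diff_left[OF X Y that u] eq[OF that u] by simp
  then have "vf_diff B X Y u = zero_tvec B u"
    using nondegenerate u X Y by (simp add: maximal_rank_def tm_fields_def carrier_slit_atlas)
  then have "vf_diff B X Y u k = zero_tvec B u k" by simp
  then show "X u k = Y u k" using k by (simp add: zero_tvec_def charts_at_def)
qed (use X Y in simp_all)

text \<open>\<open>J \<circ> J = 0\<close> makes \<open>d_J A E\<close> vanish on vertical fields;
  this removes one of the three terms of \<open>\<Omega>\<close> when an argument is a
  \<open>J\<close>-image.\<close>

lemma act_d_J_J: "u \<in> carrier_of B \<Longrightarrow> act Z (d_J A E (J X)) u = 0"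
  by (rule vf_apply_zero_fun) (simp_all add: d_J_def J_J vf_apply_zero)

lemma Omega_J_left:
  assumes "X \<in> \<XX>" "Y \<in> \<XX>" "u \<in> carrier_of B"
  shows "\<Omega> (J X) Y u = act (J X) (act (J Y) E) u - act (J \<lbrakk>J X, Y\<rbrakk>) E u"
  unfolding Omega_def act_d_J_J[OF assms(3)] by (simp add: d_J_def[abs_def])

lemma Omega_J_right:
  assumes "X \<in> \<XX>" "Y \<in> \<XX>" "u \<in> carrier_of B"
  shows "\<Omega> X (J Y) u = - act (J Y) (act (J X) E) u - act (J \<lbrakk>X, J Y\<rbrakk>) E u"
  unfolding Omega_def act_d_J_J[OF assms(3)] by (simp add: d_J_def[abs_def])

lemma nijenhuis_J_diff:
  assumes "X \<in> \<XX>" "Y \<in> \<XX>"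
  shows "\<lbrakk>J X, J Y\<rbrakk> = vf_diff B (J \<lbrakk>J X, Y\<rbrakk>) (J \<lbrakk>J Y, X\<rbrakk>)"
  unfolding nijenhuis_J[OF assms]
  by (rule ext_field_eqI[of B]) (simp_all add: bracket_antisym[of _ _ X "J Y"])

text \<open>Commuting the two vertical derivatives of \<open>E\<close> costs
  \<open>\<lbrakk>J X, J Y\<rbrakk>\<close> applied to \<open>E\<close>, which by the Nijenhuis
  identity is the difference of the bracket terms. In coordinates this is the symmetry of the fibre
  Hessian of \<open>E\<close>.\<close>

lemma Omega_J_sym:
  assumes X: "X \<in> \<XX>" and Y: "Y \<in> \<XX>" and u: "u \<in> carrier_of B"
  shows "\<Omega> (J X) Y u = \<Omega> (J Y) X u"
proof -
  have "act \<lbrakk>J X, J Y\<rbrakk> E u = act (J \<lbrakk>J X, Y\<rbrakk>) E u - act (J \<lbrakk>J Y, X\<rbrakk>) E u"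
    unfolding nijenhuis_J_diff[OF X Y] using X Y u by (simp add: vf_apply_diff)
  then show ?thesis
    using vf_apply_bracket[of "J X" "J Y" E u] X Y u by (simp add: Omega_J_left)
qed

text \<open>The relation \<open>i\<^sub>J \<Omega> = 0\<close>. It transfers the equation of the
  spray to \<open>J S\<close>.\<close>

lemma Omega_J_swap:
  assumes X: "X \<in> \<XX>" and Y: "Y \<in> \<XX>" and u: "u \<in> carrier_of B"
  shows "\<Omega> X (J Y) u = - \<Omega> (J X) Y u"
proof -
  have "act \<lbrakk>J X, J Y\<rbrakk> E u = act (J \<lbrakk>J X, Y\<rbrakk>) E u + act (J \<lbrakk>X, J Y\<rbrakk>) E u"
    unfolding nijenhuis_J[OF X Y] using X Y u by (simp add: vf_apply_add)
  then show ?thesis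
    using vf_apply_bracket[of "J X" "J Y" E u] X Y u by (simp add: Omega_J_left Omega_J_right)
qed

text \<open>Homogeneity of degree two contributes \<open>2 (J X) E\<close>, and the Lie derivative
  of \<open>J\<close> along \<open>C\<close>, being \<open>- J\<close>, takes one copy away.\<close>

lemma Omega_C:
  assumes X: "X \<in> \<XX>" and u: "u \<in> carrier_of B"
  shows "\<Omega> C X u = act (J X) E u"
proof -
  have JC: "J C = vf_zero B" by (rule ext_field_eqI[of B]) (simp_all add: zero_prod_def)
  have "act X (d_J A E C) u = 0"
    by (rule vf_apply_zero_fun) (simp_all add: d_J_def JC vf_apply_zero u)
  then have "\<Omega> C X u = act C (act (J X) E) u - act (J \<lbrakk>C, X\<rbrakk>) E u"
    unfolding Omega_def by (simp add: d_J_def[abs_def])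
  moreover have "act \<lbrakk>C, J X\<rbrakk> E u = act (J \<lbrakk>C, X\<rbrakk>) E u - act (J X) E u"
    unfolding bracket_C_J[OF X] using X u by (simp add: vf_apply_diff)
  moreover have "act \<lbrakk>C, J X\<rbrakk> E u = act C (act (J X) E) u - act (J X) (act C E) u"
    using X u by (simp add: vf_apply_bracket)
  \<comment> \<open>\<open>2 E\<close> is written as \<open>E + E\<close>, so that additivity of the
    derivative applies.\<close>
  moreover have "act (J X) (act C E) u = act (J X) (\<lambda>q. E q + E q) u"
    using u by (intro vf_apply_cong) (simp_all add: euler)
  moreover have "\<dots> = act (J X) E u + act (J X) E u"
    by (rule vf_apply_fun_add) (simp_all add: X u)
  ultimately show ?thesis by simp
qed

text \<open>The spray equation on \<open>J X\<close>, with \<open>J\<close> moved to the left slot,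
  says that \<open>J S\<close> pairs with \<open>X\<close> to \<open>(J X) E\<close>, as
  \<open>C\<close> does.\<close>

lemma J_spray:
  assumes S: "S \<in> \<XX>" and spray: "\<And>X u. X \<in> \<XX> \<Longrightarrow> u \<in> carrier_of B \<Longrightarrow> \<Omega> S X u = - act X E u"
  shows "J S = C"
proof (rule Omega_eqI)
  fix X u assume X: "X \<in> \<XX>" and u: "u \<in> carrier_of B"
  show "\<Omega> (J S) X u = \<Omega> C X u"
    using spray[OF J_in[OF X] u] Omega_J_swap[OF S X u] Omega_C[OF X u] by simp
qed (use S in simp_all)

text \<open>The Lie derivative \<open>\<L>\<^bsub>JX\<^esub>(J\<^sup>*g)\<close>, with \<open>(J\<^sup>*g)(Y, Z) = \<Omega>(JY, Z)\<close> inserted.\<close>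

definition lie_metric ::
    "('a, 'v) tm_field \<Rightarrow> ('a, 'v) tm_field \<Rightarrow> ('a, 'v) tm_field \<Rightarrow> ('a, 'v) tm \<Rightarrow> real" where
  "lie_metric X Y Z u = act (J X) (\<Omega> (J Y) Z) u - \<Omega> (J \<lbrakk>J X, Y\<rbrakk>) Z u - \<Omega> (J Y) \<lbrakk>J X, Z\<rbrakk> u"

text \<open>In coordinates: symmetry of the third fibre derivatives of \<open>E\<close>.
  Invariantly, the third-order terms differ by \<open>\<lbrakk>J X, J Y\<rbrakk>\<close> acting on
  \<open>(J Z) E\<close>, which the Nijenhuis identity absorbs, and the double brackets cancel by
  Jacobi.\<close>

lemma lie_metric_sym:
  assumes X: "X \<in> \<XX>" and Y: "Y \<in> \<XX>" and Z: "Z \<in> \<XX>" and u: "u \<in> carrier_of B"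
  shows "lie_metric X Y Z u = lie_metric Y X Z u"
proof -
  let ?f = "act (J Z) E"
  have expand: "lie_metric X Y Z u =
      act (J X) (act (J Y) ?f) u - act (J X) (act (J \<lbrakk>J Y, Z\<rbrakk>) E) u
      - act (J \<lbrakk>J X, Y\<rbrakk>) ?f u + act (J \<lbrakk>J \<lbrakk>J X, Y\<rbrakk>, Z\<rbrakk>) E u
      - act (J Y) (act (J \<lbrakk>J X, Z\<rbrakk>) E) u + act (J \<lbrakk>J Y, \<lbrakk>J X, Z\<rbrakk>\<rbrakk>) E u"
    if X: "X \<in> \<XX>" and Y: "Y \<in> \<XX>" for X Y
  proof -
    have "act (J X) (\<Omega> (J Y) Z) u = act (J X) (act (J Y) ?f) u - act (J X) (act (J \<lbrakk>J Y, Z\<rbrakk>) E) u"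
      by (rule act_fun_diff_cong) (use X Y Z u in \<open>simp_all add: Omega_J_left\<close>)
    then show ?thesis unfolding lie_metric_def using X Y Z u by (simp add: Omega_J_left)
  qed
  have 1: "act \<lbrakk>J X, J Y\<rbrakk> ?f u = act (J \<lbrakk>J X, Y\<rbrakk>) ?f u - act (J \<lbrakk>J Y, X\<rbrakk>) ?f u"
    unfolding nijenhuis_J_diff[OF X Y] using X Y Z u by (simp add: vf_apply_diff)
  have "J \<lbrakk>\<lbrakk>J X, J Y\<rbrakk>, Z\<rbrakk> = vf_diff B (J \<lbrakk>J \<lbrakk>J X, Y\<rbrakk>, Z\<rbrakk>) (J \<lbrakk>J \<lbrakk>J Y, X\<rbrakk>, Z\<rbrakk>)"
    unfolding nijenhuis_J_diff[OF X Y] using X Y Z by (simp add: bracket_diff_left J_diff)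
  then have 2: "act (J \<lbrakk>\<lbrakk>J X, J Y\<rbrakk>, Z\<rbrakk>) E u =
      act (J \<lbrakk>J \<lbrakk>J X, Y\<rbrakk>, Z\<rbrakk>) E u - act (J \<lbrakk>J \<lbrakk>J Y, X\<rbrakk>, Z\<rbrakk>) E u"
    using X Y Z u by (simp add: vf_apply_diff)
  have "J \<lbrakk>\<lbrakk>J X, J Y\<rbrakk>, Z\<rbrakk> = vf_diff B (J \<lbrakk>J X, \<lbrakk>J Y, Z\<rbrakk>\<rbrakk>) (J \<lbrakk>J Y, \<lbrakk>J X, Z\<rbrakk>\<rbrakk>)"
    using X Y Z by (simp add: jacobi J_diff)
  then have 3: "act (J \<lbrakk>\<lbrakk>J X, J Y\<rbrakk>, Z\<rbrakk>) E u =
      act (J \<lbrakk>J X, \<lbrakk>J Y, Z\<rbrakk>\<rbrakk>) E u - act (J \<lbrakk>J Y, \<lbrakk>J X, Z\<rbrakk>\<rbrakk>) E u"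
    using X Y Z u by (simp add: vf_apply_diff)
  have 4: "act \<lbrakk>J X, J Y\<rbrakk> ?f u = act (J X) (act (J Y) ?f) u - act (J Y) (act (J X) ?f) u"
    using X Y Z u by (simp add: vf_apply_bracket)
  show ?thesis using expand[OF X Y] expand[OF Y X] 1 2 3 4 by simp
qed

end

section \<open>The metric on vertical fields and the Hashiguchi connection\<close>

locale finsler_spray = finsler A E + semispray A S
  for A :: "('a, 'v::euclidean_space) chart set" and E :: "('a, 'v) tm \<Rightarrow> real" and S :: "('a, 'v) tm_field"
begin

text \<open>The definition chooses some \<open>Y'\<close> with \<open>J Y' = J Y\<close>. Symmetry
  moves it to the left slot, where only \<open>J Y'\<close> is visible.\<close>

lemma vertical_metric_J:
  assumes X: "X \<in> \<XX>" and Y: "Y \<in> \<XX>" and u: "u \<in> carrier_of B"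
  shows "vertical_metric A E (J X) (J Y) u = \<Omega> (J X) Y u"
proof -
  define Y' where "Y' = (SOME Y'. Y' \<in> \<XX> \<and> J Y' = J Y)"
  have Y': "Y' \<in> \<XX>" "J Y' = J Y" unfolding Y'_def by (rule someI2[of _ Y]; use Y in simp)+
  have "vertical_metric A E (J X) (J Y) u = \<Omega> (J X) Y' u"
    by (simp add: vertical_metric_def tm_fields_def Y'_def)
  also have "\<dots> = \<Omega> (J X) Y u"
    using Omega_J_sym[OF X Y'(1) u] Omega_J_sym[OF X Y u] Y'(2) by simp
  finally show ?thesis .
qed

lemma metric_J:
  assumes X: "X \<in> \<XX>" and Y: "Y \<in> \<XX>" and u: "u \<in> carrier_of B"
  shows "metric A E S (J X) (J Y) u = \<Omega> (J X) Y u"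
proof -
  have "vertical_metric A E (J (J X)) (J (J Y)) u = 0"
    using vertical_metric_J[of "J X" "J Y" u] X Y u by (simp add: J_J Omega_zero_left)
  then show ?thesis
    unfolding metric_def v_J[OF X] v_J[OF Y] vertical_metric_J[OF X Y u] by simp
qed

lemma lie_derivative_J_pullback_metric:
  assumes X: "X \<in> \<XX>" and Y: "Y \<in> \<XX>" and Z: "Z \<in> \<XX>" and u: "u \<in> carrier_of B"
  shows "lie_derivative2 B (J X) (J_pullback_metric A E S) Y Z u = lie_metric X Y Z u"
proof -
  have "act (J X) (metric A E S (J Y) (J Z)) u = act (J X) (\<Omega> (J Y) Z) u"
    by (rule vf_apply_cong) (simp_all add: metric_J Y Z u)
  then show ?thesis
    unfolding lie_derivative2_def lie_metric_def J_pullback_metric_def using X Y Z u by (simp add: metric_J)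
qed

text \<open>Non-degeneracy makes the description unique, so \<open>THE\<close> returns any vertical
  solution of the defining equation, which is stated here multiplied by 2.\<close>

lemma cartan_eqI:
  assumes X: "X \<in> \<XX>" and Y: "Y \<in> \<XX>" and W: "W \<in> \<XX>" "J W = vf_zero B"
    and eq: "\<And>Z u. Z \<in> \<XX> \<Longrightarrow> u \<in> carrier_of B \<Longrightarrow> 2 * \<Omega> W Z u = lie_metric X Y Z u"
  shows "cartan A E S X Y = W"
  unfolding cartan_def tm_fields_def carrier_slit_atlas[symmetric]
proof (rule the_equality, intro conjI ballI)
  have *: "1/2 * lie_derivative2 B (J X) (J_pullback_metric A E S) Y Z u = \<Omega> W Z u"
    if "Z \<in> \<XX>" "u \<in> carrier_of B" for Z u
    using lie_derivative_J_pullback_metric[OF X Y that] eq[OF that] by simp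
  show "\<Omega> W Z u = 1/2 * lie_derivative2 B (J X) (J_pullback_metric A E S) Y Z u"
    if "Z \<in> \<XX>" "u \<in> carrier_of B" for Z u using *[OF that] ..
  show "W' = W" if "W' \<in> \<XX> \<and> J W' = vf_zero B \<and> (\<forall>Z\<in>\<XX>. \<forall>u\<in>carrier_of B.
      \<Omega> W' Z u = 1/2 * lie_derivative2 B (J X) (J_pullback_metric A E S) Y Z u)" for W'
    by (rule Omega_eqI) (use that * W in auto)
qed (fact W)+

text \<open>Apply \<open>v\<close> to the three terms of the mixed torsion: the first is a
  \<open>J\<close>-image and survives, the second is the derivative of a horizontal field and
  disappears, so the first must balance the bracket.\<close>

lemma hashiguchi_horizontal:
  assumes D: "hashiguchi_connection A E S D" and X: "X \<in> \<XX>" and Y: "Y \<in> \<XX>"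
  shows "D (h X) (J Y) = v \<lbrakk>h X, J Y\<rbrakk>"
proof -
  have lin: "linear_connection B D" and J: "parallel11 B D J" and \<Gamma>: "parallel11 B D \<Gamma>"
    and tor: "v (torsion B D (h X) (J Y)) = vf_zero B"
    using D X Y by (auto simp: hashiguchi_connection_def lift_of_barthel_def tm_fields_def)
  have "v (D (h X) (J Y)) = D (h X) (J Y)"
    using J X Y lin by (simp add: parallel11_def v_J)
  moreover have "v (D (J Y) (h X)) = vf_zero B"
    using parallel_h[OF lin \<Gamma> J_in[OF Y] X] X Y lin by (simp add: v_h)
  ultimately have eq: "vf_diff B (vf_diff B (D (h X) (J Y)) (vf_zero B)) (v \<lbrakk>h X, J Y\<rbrakk>) = vf_zero B"
    using tor X Y lin by (simp add: torsion_def v_diff)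
  show ?thesis
  proof (rule ext_field_eqI[of B])
    show "D (h X) (J Y) u k = v \<lbrakk>h X, J Y\<rbrakk> u k" if "k \<in> B" "u \<in> dom_of k" for u k
      using arg_cong[OF eq, of "\<lambda>Z. Z u k"] that by simp
  qed (use X Y lin in simp_all)
qed

lemma hashiguchi_vertical:
  assumes D: "hashiguchi_connection A E S D" and X: "X \<in> \<XX>" and Y: "Y \<in> \<XX>"
  shows "cartan A E S X Y = vf_diff B (D (J X) (J Y)) (J \<lbrakk>J X, Y\<rbrakk>)"
proof -
  have lin: "linear_connection B D" and J: "parallel11 B D J"
    and met: "\<And>X Y Z u. X \<in> \<XX> \<Longrightarrow> Y \<in> \<XX> \<Longrightarrow> Z \<in> \<XX> \<Longrightarrow> u \<in> carrier_of B \<Longrightarrow>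
        covariant_derivative2 B D (J X) (metric A E S) Y Z u = 0"
    and tor: "\<And>X Y. X \<in> \<XX> \<Longrightarrow> Y \<in> \<XX> \<Longrightarrow> torsion B D (J X) (J Y) = vf_zero B"
    using D by (auto simp: hashiguchi_connection_def lift_of_barthel_def tm_fields_def carrier_slit_atlas)
  have DJ: "D Z (J W) = J (D Z W)" if "Z \<in> \<XX>" "W \<in> \<XX>" for Z W
    using J that by (simp add: parallel11_def)
  define W where "W X Y = vf_diff B (D (J X) (J Y)) (J \<lbrakk>J X, Y\<rbrakk>)" for X Y
  have W_in: "W X Y \<in> \<XX>" if "X \<in> \<XX>" "Y \<in> \<XX>" for X Y using that lin by (simp add: W_def)
  \<comment> \<open>The Nijenhuis identity splits \<open>\<lbrakk>J X, J Y\<rbrakk>\<close> into the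
    two bracket corrections, so the vertical torsion is \<open>W X Y - W Y X\<close>.\<close>
  have W_sym: "W X Y = W Y X" if X: "X \<in> \<XX>" and Y: "Y \<in> \<XX>" for X Y
  proof (rule ext_field_eqI[of B])
    show "W X Y u k = W Y X u k" if k: "k \<in> B" "u \<in> dom_of k" for u k
      using arg_cong[OF tor[OF X Y], of "\<lambda>Z. Z u k"] k
      unfolding torsion_def nijenhuis_J_diff[OF X Y] W_def
      by (simp only: vf_diff_apply vf_zero_apply) (simp add: algebra_simps)
  qed (use W_in that in simp_all)
  have W_metric: "lie_metric X Y Z u = \<Omega> (W X Y) Z u + \<Omega> (W X Z) Y u"
    if X: "X \<in> \<XX>" and Y: "Y \<in> \<XX>" and Z: "Z \<in> \<XX>" and u: "u \<in> carrier_of B" for X Y Z u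
  proof -
    have "act (J X) (\<Omega> (J Y) Z) u = act (J X) (metric A E S (J Y) (J Z)) u"
      by (rule vf_apply_cong) (simp_all add: metric_J Y Z u)
    \<comment> \<open>Metricity is used with the vertical arguments \<open>J Y\<close> and
      \<open>J Z\<close>, where the metric reduces to \<open>\<Omega>\<close>.\<close>
    also have "\<dots> = \<Omega> (D (J X) (J Y)) Z u + \<Omega> (J Y) (D (J X) Z) u"
      using met[of X "J Y" "J Z" u] X Y Z u lin
      by (simp add: covariant_derivative2_def DJ metric_J)
    also have "\<Omega> (J Y) (D (J X) Z) u = \<Omega> (D (J X) (J Z)) Y u"
      using Omega_J_sym[OF Y _ u, of "D (J X) Z"] X Z lin by (simp add: DJ)
    finally have "act (J X) (\<Omega> (J Y) Z) u = \<Omega> (D (J X) (J Y)) Z u + \<Omega> (D (J X) (J Z)) Y u" .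
    moreover have "\<Omega> (J Y) \<lbrakk>J X, Z\<rbrakk> u = \<Omega> (J \<lbrakk>J X, Z\<rbrakk>) Y u"
      using Omega_J_sym[OF Y _ u] X Z by simp
    ultimately show ?thesis
      unfolding lie_metric_def W_def using X Y Z u lin by (simp add: Omega_diff_left)
  qed
  have "cartan A E S X Y = W X Y"
  proof (rule cartan_eqI[OF X Y W_in[OF X Y]])
    show "J (W X Y) = vf_zero B"
      using X Y lin by (simp add: W_def J_diff DJ J_J vf_diff_self)
    fix Z u assume Z: "Z \<in> \<XX>" and u: "u \<in> carrier_of B"
    \<comment> \<open>\<open>W_metric\<close> shows symmetry in the last two arguments;
      \<open>lie_metric_sym\<close> gives the first two.\<close>
    have "lie_metric Z X Y u = lie_metric X Y Z u"
      using lie_metric_sym[OF Z X Y u] W_metric[OF X Y Z u] W_metric[OF X Z Y u] by simp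
    \<comment> \<open>With \<open>L = lie_metric\<close>, the sum
      \<open>L X Y Z + L Y X Z - L Z X Y\<close> expands to twice \<open>\<Omega> (W X Y) Z\<close>
      because \<open>W\<close> is symmetric, while total symmetry reduces it to
      \<open>L X Y Z\<close>.\<close>
    then show "2 * \<Omega> (W X Y) Z u = lie_metric X Y Z u"
      using lie_metric_sym[OF X Y Z u] W_metric[OF X Y Z u] W_metric[OF Y X Z u] W_metric[OF Z X Y u]
        W_sym[OF X Y] W_sym[OF X Z] W_sym[OF Y Z] by simp
  qed
  then show ?thesis by (simp add: W_def)
qed

end

theorem theorem4p9:
  fixes M :: "'a topology" and A :: "('a, 'v::euclidean_space) chart set"
    and E :: "('a, 'v) tm \<Rightarrow> real"
    and S :: "('a, 'v) tm_field"
    and Dcirc Dstar :: "('a, 'v) tm_connection"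
  assumes "finsler_manifold M A E"
    and "canonical_spray A E S"
    and "berwald_connection A S Dcirc"
    and "hashiguchi_connection A E S Dstar"
  shows
    "((\<forall>\<zeta>\<in>tm_fields A. \<forall>\<eta>\<in>tm_fields A.
         Dstar (almost_tangent A \<zeta>) (almost_tangent A \<eta>) =
           vf_add (slit_atlas A) (Dcirc (almost_tangent A \<zeta>) (almost_tangent A \<eta>)) (cartan A E S \<zeta> \<eta>)) \<and>
      (\<forall>\<zeta>\<in>tm_fields A. \<forall>\<eta>\<in>tm_fields A.
         Dstar (h_proj A S \<zeta>) (almost_tangent A \<eta>) = Dcirc (h_proj A S \<zeta>) (almost_tangent A \<eta>)) \<and>
      parallel11 (slit_atlas A) Dstar (almost_complex A S)) \<and>
     (\<forall>D. linear_connection (slit_atlas A) D \<and>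
        (\<forall>\<zeta>\<in>tm_fields A. \<forall>\<eta>\<in>tm_fields A.
           D (almost_tangent A \<zeta>) (almost_tangent A \<eta>) =
             vf_add (slit_atlas A) (Dcirc (almost_tangent A \<zeta>) (almost_tangent A \<eta>)) (cartan A E S \<zeta> \<eta>)) \<and>
        (\<forall>\<zeta>\<in>tm_fields A. \<forall>\<eta>\<in>tm_fields A.
           D (h_proj A S \<zeta>) (almost_tangent A \<eta>) = Dcirc (h_proj A S \<zeta>) (almost_tangent A \<eta>)) \<and>
        parallel11 (slit_atlas A) D (almost_complex A S)
        \<longrightarrow> (\<forall>\<zeta>\<in>tm_fields A. \<forall>\<eta>\<in>tm_fields A. D \<zeta> \<eta> = Dstar \<zeta> \<eta>))"
proof -
  interpret slit_bundle_atlas A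
    using assms(1) smooth_atlas_of_manifold unfolding slit_bundle_atlas_def finsler_manifold_def by blast
  interpret finsler A E
    using assms(1) by unfold_locales (simp_all add: finsler_manifold_def carrier_slit_atlas)
  have S: "S \<in> \<XX>" using assms(2) by (simp add: canonical_spray_def tm_fields_def)
  interpret finsler_spray A E S
    using J_spray[OF S] assms(2) S
    by unfold_locales (simp_all add: canonical_spray_def tm_fields_def carrier_slit_atlas)
  have lin: "linear_connection B Dstar" and par: "parallel11 B Dstar F"
    using assms(4) parallel_almost_complex by (auto simp: hashiguchi_connection_def lift_of_barthel_def)
  have a: "Dstar (J X) (J Y) = vf_add B (Dcirc (J X) (J Y)) (cartan A E S X Y)" if "X \<in> \<XX>" "Y \<in> \<XX>" for X Y
  proof -
    \<comment> \<open>The Berwald value is exactly the term that the Cartan tensor subtracts from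
      the Hashiguchi derivative.\<close>
    have "Dcirc (J X) (J Y) = J \<lbrakk>J X, Y\<rbrakk>"
      using assms(3) that by (simp add: berwald_connection_def tm_fields_def)
    then show ?thesis
      unfolding hashiguchi_vertical[OF assms(4) that] using that lin
      by (intro ext_field_eqI[of B]) simp_all
  qed
  \<comment> \<open>Both sides are \<open>v \<lbrakk>h X, J Y\<rbrakk>\<close>.\<close>
  have b: "Dstar (h X) (J Y) = Dcirc (h X) (J Y)" if "X \<in> \<XX>" "Y \<in> \<XX>" for X Y
    using assms(3) that hashiguchi_horizontal[OF assms(4) that]
    by (simp add: berwald_connection_def tm_fields_def)
  show ?thesis
    unfolding tm_fields_def
  proof (intro conjI ballI allI impI)
    fix D X Y
    assume D: "linear_connection B D \<and>
        (\<forall>\<zeta>\<in>\<XX>. \<forall>\<eta>\<in>\<XX>. D (J \<zeta>) (J \<eta>) = vf_add B (Dcirc (J \<zeta>) (J \<eta>)) (cartan A E S \<zeta> \<eta>)) \<and>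
        (\<forall>\<zeta>\<in>\<XX>. \<forall>\<eta>\<in>\<XX>. D (h \<zeta>) (J \<eta>) = Dcirc (h \<zeta>) (J \<eta>)) \<and> parallel11 B D F"
      and XY: "X \<in> \<XX>" "Y \<in> \<XX>"
    show "D X Y = Dstar X Y"
      by (rule connection_eqI[OF _ _ lin par _ _ XY]) (use D a b in simp_all)
  qed (use a b par in simp_all)
qed

end
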